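(* Let $T=\{(x,y)\in\mathbb{R}^2: x+y>0\}$ and $\overline T=\{(x,y)\in\mathbb{R}^2: x+y\ge 0\}$, with the product order from $\mathbb{R}^2$. (i) Every pointwise finite-dimensional middle exact persistence module $M\colon T\to\mathbf{Vec}$ is isomorphic to a direct sum of modules $k_{J\cap T}$ with $J\subseteq\mathbb{R}^2$ a block and $J\cap T\neq\emptyset$. (ii) Every pointwise finite-dimensional middle exact persistence module $N\colon \overline T\to\mathbf{Vec}$ is isomorphic to a direct sum of modules $k_{J\cap \overline T}$ with $J\subseteq\mathbb{R}^2$ a block and $J\cap\overline T\ne\emptyset$.
   Context: $\mathbb{R}^2$ has the product order $(x,y)\le(x',y')$ iff $x\le x'$ and $y\le y'$. Persistence modules over a poset are functors to $k$-vector spaces with structure maps $M(p\le q)$; pointwise finite-dimensional means each $M_p$ finite-dimensional. For $Q\in\{T,\overline T\}$, a module $M\colon Q\to\mathbf{Vec}$ is middle exact if for all $x\le x'$, $y\le y'$ with $a=(x,y)$, $b=(x,y')$, $c=(x',y)$, $d=(x',y')$ all in $Q$, the sequence $M_a\xrightarrow{(M(a\le b),M(a\le c))}M_b\oplus M_c\xrightarrow{M(b\le d)-M(c\le d)}M_d$ is exact at the middle. A block in $\mathbb{R}^2$ is a non-empty subset of one of the forms: (db) $J_1\times J_2$ with $J_1,J_2\subseteq\mathbb{R}$ non-empty downward-closed; (bb) $J_1\times J_2$ with $J_1,J_2$ non-empty upward-closed; (vb) $J_1\times\mathbb{R}$ with $J_1$ a non-empty convex subset of $\mathbb{R}$; (hb)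 $\mathbb{R}\times J_2$ with $J_2$ non-empty convex. For a subset $B$ of the indexing poset, $k_B$ is $k$ on $B$, $0$ elsewhere, with identity maps between points of $B$ and zero maps otherwise. *)

theory Defs
  imports Complex_Main
begin

definition le2 :: "real \<times> real \<Rightarrow> real \<times> real \<Rightarrow> bool" where
  "le2 p q \<longleftrightarrow> fst p \<le> fst q \<and> snd p \<le> snd q"

definition T_open :: "(real \<times> real) set" where
  "T_open = {(x, y). x + y > 0}"

definition T_closed :: "(real \<times> real) set" where
  "T_closed = {(x, y). x + y \<ge> 0}"

definition down_closed :: "real set \<Rightarrow> bool" where
  "down_closed J \<longleftrightarrow> (\<forall>x\<in>J. \<forall>y. y \<le> x \<longrightarrow> y \<in> J)"

definition up_closed :: "real set \<Rightarrow> bool" where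
  "up_closed J \<longleftrightarrow> (\<forall>x\<in>J. \<forall>y. x \<le> y \<longrightarrow> y \<in> J)"

definition ord_convex :: "real set \<Rightarrow> bool" where
  "ord_convex J \<longleftrightarrow> (\<forall>a\<in>J. \<forall>b\<in>J. \<forall>c. a \<le> c \<and> c \<le> b \<longrightarrow> c \<in> J)"

definition is_block :: "(real \<times> real) set \<Rightarrow> bool" where
  "is_block B \<longleftrightarrow> B \<noteq> {} \<and>
     ((\<exists>J1 J2. J1 \<noteq> {} \<and> J2 \<noteq> {} \<and> down_closed J1 \<and> down_closed J2 \<and> B = J1 \<times> J2) \<or>
      (\<exists>J1 J2. J1 \<noteq> {} \<and> J2 \<noteq> {} \<and> up_closed J1 \<and> up_closed J2 \<and> B = J1 \<times> J2) \<or>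
      (\<exists>J1. J1 \<noteq> {} \<and> ord_convex J1 \<and> B = J1 \<times> UNIV) \<or>
      (\<exists>J2. J2 \<noteq> {} \<and> ord_convex J2 \<and> B = UNIV \<times> J2))"

definition pers_module ::
  "('k::field \<Rightarrow> 'v::ab_group_add \<Rightarrow> 'v) \<Rightarrow> (real \<times> real) set \<Rightarrow>
   (real \<times> real \<Rightarrow> 'v set) \<Rightarrow> (real \<times> real \<Rightarrow> real \<times> real \<Rightarrow> 'v \<Rightarrow> 'v) \<Rightarrow> bool" where
  "pers_module s Q V f \<longleftrightarrow>
     vector_space s \<and>
     (\<forall>p\<in>Q. module.subspace s (V p)) \<and>
     (\<forall>p\<in>Q. \<forall>q\<in>Q. le2 p q \<longrightarrow>
        (\<forall>x\<in>V p. f p q x \<in> V q) \<and>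
        (\<forall>x\<in>V p. \<forall>y\<in>V p. f p q (x + y) = f p q x + f p q y) \<and>
        (\<forall>a. \<forall>x\<in>V p. f p q (s a x) = s a (f p q x))) \<and>
     (\<forall>p\<in>Q. \<forall>x\<in>V p. f p p x = x) \<and>
     (\<forall>p\<in>Q. \<forall>q\<in>Q. \<forall>r\<in>Q. le2 p q \<and> le2 q r \<longrightarrow>
        (\<forall>x\<in>V p. f q r (f p q x) = f p r x))"

definition pointwise_fin_dim ::
  "('k::field \<Rightarrow> 'v::ab_group_add \<Rightarrow> 'v) \<Rightarrow> (real \<times> real) set \<Rightarrow>
   (real \<times> real \<Rightarrow> 'v set) \<Rightarrow> bool" where
  "pointwise_fin_dim s Q V \<longleftrightarrow>
     (\<forall>p\<in>Q. \<exists>B. finite B \<and> B \<subseteq> V p \<and> module.span s B = V p)"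

text \<open>Middle exactness: for a=(x,y), b=(x,y'), c=(x',y), d=(x',y') in Q, the
  sequence M_a \<rightarrow> M_b \<oplus> M_c \<rightarrow> M_d (second map: difference) is exact at the
  middle, i.e. the kernel of the second map equals the image of the first.\<close>

definition middle_exact ::
  "(real \<times> real) set \<Rightarrow> (real \<times> real \<Rightarrow> 'v::ab_group_add set) \<Rightarrow>
   (real \<times> real \<Rightarrow> real \<times> real \<Rightarrow> 'v \<Rightarrow> 'v) \<Rightarrow> bool" where
  "middle_exact Q V f \<longleftrightarrow>
     (\<forall>x x' y y'. x \<le> x' \<and> y \<le> y' \<and>
        (x, y) \<in> Q \<and> (x, y') \<in> Q \<and> (x', y) \<in> Q \<and> (x', y') \<in> Q \<longrightarrow>
        (\<forall>u\<in>V (x, y'). \<forall>w\<in>V (x', y).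
           (f (x, y') (x', y') u - f (x', y) (x', y') w = 0) \<longleftrightarrow>
           (\<exists>z\<in>V (x, y). f (x, y) (x, y') z = u \<and> f (x, y) (x', y) z = w)))"

text \<open>The external direct sum of the modules k_{J i \<inter> Q}, i \<in> I: at p it is the
  space of finitely supported families c : 'i \<Rightarrow> 'k supported on
  {i \<in> I. p \<in> J i \<inter> Q}; the structure map p \<le> q acts componentwise as the
  identity when q \<in> J i \<inter> Q and as zero otherwise.\<close>

definition dsum_space ::
  "(real \<times> real) set \<Rightarrow> 'i set \<Rightarrow> ('i \<Rightarrow> (real \<times> real) set) \<Rightarrow>
   real \<times> real \<Rightarrow> ('i \<Rightarrow> 'k::field) set" where
  "dsum_space Q I J p =
     {c. finite {i. c i \<noteq> 0} \<and> (\<forall>i. c i \<noteq> 0 \<longrightarrow> i \<in> I \<and> p \<in> J i \<inter> Q)}"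

definition dsum_map ::
  "(real \<times> real) set \<Rightarrow> ('i \<Rightarrow> (real \<times> real) set) \<Rightarrow>
   real \<times> real \<Rightarrow> real \<times> real \<Rightarrow> ('i \<Rightarrow> 'k::field) \<Rightarrow> ('i \<Rightarrow> 'k)" where
  "dsum_map Q J p q c = (\<lambda>i. if q \<in> J i \<inter> Q then c i else 0)"

definition iso_to_dsum ::
  "('k::field \<Rightarrow> 'v::ab_group_add \<Rightarrow> 'v) \<Rightarrow> (real \<times> real) set \<Rightarrow>
   (real \<times> real \<Rightarrow> 'v set) \<Rightarrow> (real \<times> real \<Rightarrow> real \<times> real \<Rightarrow> 'v \<Rightarrow> 'v) \<Rightarrow>
   'i set \<Rightarrow> ('i \<Rightarrow> (real \<times> real) set) \<Rightarrow> bool" where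
  "iso_to_dsum s Q V f I J \<longleftrightarrow>
     (\<exists>\<phi> :: real \<times> real \<Rightarrow> 'v \<Rightarrow> ('i \<Rightarrow> 'k).
        (\<forall>p\<in>Q. bij_betw (\<phi> p) (V p) (dsum_space Q I J p) \<and>
           (\<forall>x\<in>V p. \<forall>y\<in>V p. \<forall>i. \<phi> p (x + y) i = \<phi> p x i + \<phi> p y i) \<and>
           (\<forall>a. \<forall>x\<in>V p. \<forall>i. \<phi> p (s a x) i = a * \<phi> p x i)) \<and>
        (\<forall>p\<in>Q. \<forall>q\<in>Q. le2 p q \<longrightarrow>
           (\<forall>x\<in>V p. \<phi> q (f p q x) = dsum_map Q J p q (\<phi> p x))))"

definition block_decomposable ::
  "('k::field \<Rightarrow> 'v::ab_group_add \<Rightarrow> 'v) \<Rightarrow> (real \<times> real) set \<Rightarrow>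
   (real \<times> real \<Rightarrow> 'v set) \<Rightarrow> (real \<times> real \<Rightarrow> real \<times> real \<Rightarrow> 'v \<Rightarrow> 'v) \<Rightarrow> bool" where
  "block_decomposable s Q V f \<longleftrightarrow>
     (\<exists>(I :: (real \<times> real \<times> nat) set) J.
        (\<forall>i\<in>I. is_block (J i) \<and> J i \<inter> Q \<noteq> {}) \<and> iso_to_dsum s Q V f I J)"

end

theory Submission
  imports Defs "HOL-Library.Function_Algebras" "HOL-Library.Countable_Set"
begin

text \<open>
  By Zorn's lemma there is a maximal family of pairwise orthogonal block summands. Its common kernel
  is again pointwise finite-dimensional and middle exact, so it suffices to split one block off every
  nonzero module.

  If some element dies both horizontally and vertically, middle exactness lets it be lifted downwards
  along the whole death block, compatibly by linear compactness, and it generates a death block. If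
  there is no such element but some element dies horizontally, the horizontally dying elements are
  constant in the vertical direction, and one of minimal lifetime generates a vertical band;
  dually for vertical death. Otherwise all maps are injective, the module is the intersection of two
  filtrations of its colimit, and an element of the smallest nonzero step generates an up-closed block.

  In each case the block is directed, so the retraction is a functional on the colimit over it that
  separates the generator from everything arriving from outside the block.
\<close>

text \<open>The obstacle is the shape of the index set: it has no least point, its rows and columns
  end at an antidiagonal, and two of its points need not have a common lower bound in it. Hence
  elements can be compared only further up, at joins, and downward lifts are first made to an
  antidiagonal. All that is used of the index set is that it is upward closed and that every finite
  subset lies above a full antidiagonal contained in it; both half-planes and their transposes have
  this property.

  A second difficulty is that interval ends may or may not be attained. Intervals are therefore
  never given by endpoints but by conditions such as "the generator survives at \<open>a\<close>",
  and infima of parameters are replaced by least members of chains of subspaces of one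
  finite-dimensional space.

  The maximal family may be infinite, but only finitely many of its blocks contain a given point,
  because the generators there are independent. So the projection onto the summands is a finite sum
  at every point.\<close>

declare split_paired_All [simp del] split_paired_Ex [simp del]

section \<open>Linear algebra\<close>

context vector_space
begin

text \<open>A member of least dimension is minimal: a basis of a smaller member extends to a basis
  of \<open>C\<close>, and equal dimensions leave no room for a new vector. The finite spanning set
  keeps these bases finite.\<close>

lemma minimal_subspace_exists:
  assumes "finite B" "\<C> \<noteq> {}" and C: "\<And>C. C \<in> \<C> \<Longrightarrow> subspace C \<and> C \<subseteq> span B"
  obtains C where "C \<in> \<C>" "\<And>C'. C' \<in> \<C> \<Longrightarrow> C' \<subseteq> C \<Longrightarrow> C' = C"
proof -
  obtain C where CC: "C \<in> \<C>" and least: "\<And>C'. C' \<in> \<C> \<Longrightarrow> dim C \<le> dim C'"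
    using ex_has_least_nat[of "\<lambda>C. C \<in> \<C>" _ dim] assms(2) by blast
  have "C' = C" if "C' \<in> \<C>" "C' \<subseteq> C" for C'
  proof -
    obtain B' where B': "B' \<subseteq> C'" "independent B'" "C' \<subseteq> span B'" "card B' = dim C'"
      by (rule basis_exists)
    obtain B'' where B'': "B' \<subseteq> B''" "B'' \<subseteq> C" "independent B''" "C \<subseteq> span B''"
      using maximal_independent_subset_extend[OF order_trans[OF B'(1) \<open>C' \<subseteq> C\<close>] B'(2)] .
    have "B'' \<subseteq> span B" using B''(2) C[OF CC] by blast
    then have "finite B''"
      using independent_span_bound[OF \<open>finite B\<close> B''(3)] by simp
    moreover have "card B'' \<le> card B'"
      unfolding B'(4) basis_card_eq_dim[OF B''(2,4,3)] by (rule least[OF \<open>C' \<in> \<C>\<close>])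
    ultimately have "B' = B''"
      using card_seteq[of B'' B'] B''(1) by blast
    then have "C \<subseteq> span B'" using B''(4) by simp
    moreover have "span B' \<subseteq> C'" using B'(1) C[OF \<open>C' \<in> \<C>\<close>] by (simp add: span_minimal)
    ultimately show "C' = C" using \<open>C' \<subseteq> C\<close> by simp
  qed
  then show thesis by (rule that[OF CC])
qed

text \<open>In a chain, a minimal nonzero member is the least one. What is chosen is a subspace; the
  infimum of the parameters that give it need not be attained.\<close>

lemma least_nonzero_subspace:
  fixes D :: "real \<Rightarrow> 'b set"
  assumes "finite B" and D: "\<And>t. subspace (D t) \<and> D t \<subseteq> span B"
    and chain: "\<And>t u. D t \<subseteq> D u \<or> D u \<subseteq> D t" and ne: "D t0 \<noteq> {0}"
  obtains t where "D t \<noteq> {0}" "\<And>u. D u \<noteq> {0} \<Longrightarrow> D t \<subseteq> D u"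
proof -
  have "{D t |t. D t \<noteq> {0}} \<noteq> {}" using ne by blast
  then obtain C where C: "C \<in> {D t |t. D t \<noteq> {0}}"
    and least: "\<And>C'. C' \<in> {D t |t. D t \<noteq> {0}} \<Longrightarrow> C' \<subseteq> C \<Longrightarrow> C' = C"
    using minimal_subspace_exists[OF assms(1), of "{D t |t. D t \<noteq> {0}}"] D by (smt (verit) mem_Collect_eq)
  from C obtain t where t: "C = D t" "D t \<noteq> {0}" by blast
  have "D t \<subseteq> D u" if "D u \<noteq> {0}" for u
    using chain[of t u] least[of "D u"] that t by blast
  then show thesis using that t by blast
qed

lemma separating_functional:
  assumes "subspace R" "x \<notin> R"
  obtains \<phi> where "Vector_Spaces.linear scale (*) \<phi>" "\<phi> x = 1" "\<And>y. y \<in> R \<Longrightarrow> \<phi> y = 0"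
proof -
  interpret k: vector_space "(*) :: 'a \<Rightarrow> 'a \<Rightarrow> 'a"
    by unfold_locales (auto simp: algebra_simps)
  interpret vp: vector_space_pair scale "(*) :: 'a \<Rightarrow> 'a \<Rightarrow> 'a" ..
  obtain B where B: "B \<subseteq> R" "independent B" "R \<subseteq> span B"
    by (rule basis_exists)
  have sB: "span B = R" using B assms by (simp add: span_subspace)
  then have "independent (insert x B)"
    using B assms by (simp add: independent_insertI)
  from vp.linear_independent_extend[OF this, of "\<lambda>y. if y = x then 1 else 0"]
  obtain \<phi> where lin: "Vector_Spaces.linear scale (*) \<phi>"
    and \<phi>: "\<forall>y\<in>insert x B. \<phi> y = (if y = x then 1 else 0)" by blast
  have xB: "x \<notin> B" using assms B by blast
  have "\<phi> y = 0" if "y \<in> R" for y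
  proof -
    from that have "y \<in> span B" by (simp add: sB)
    then show ?thesis
      by (rule vp.linear_eq_0_on_span[OF lin, rotated]) (use \<phi> xB in auto)
  qed
  then show thesis using that lin \<phi> by simp
qed

end

lemma vector_space_fun:
  assumes "vector_space s"
  shows "vector_space (\<lambda>a (c :: 'i \<Rightarrow> 'v::ab_group_add) i. s a (c i))"
proof -
  interpret vector_space s by fact
  show ?thesis
    by unfold_locales (auto simp: scale_right_distrib scale_left_distrib)
qed

section \<open>Blocks and middle exact modules\<close>

lemma le2_Pair [simp]: "le2 (a, b) (c, d) \<longleftrightarrow> a \<le> c \<and> b \<le> d"
  by (simp add: le2_def)

lemma le2_refl [simp]: "le2 p p"
  by (simp add: le2_def)

lemma le2_trans: "le2 p q \<Longrightarrow> le2 q r \<Longrightarrow> le2 p r"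
  by (auto simp: le2_def)

lemma is_block_death:
  "I \<noteq> {} \<Longrightarrow> I' \<noteq> {} \<Longrightarrow> down_closed I \<Longrightarrow> down_closed I' \<Longrightarrow> is_block (I \<times> I')"
  unfolding is_block_def by (rule conjI, simp, rule disjI1, rule exI[of _ I], rule exI[of _ I'], simp)

lemma is_block_birth:
  "I \<noteq> {} \<Longrightarrow> I' \<noteq> {} \<Longrightarrow> up_closed I \<Longrightarrow> up_closed I' \<Longrightarrow> is_block (I \<times> I')"
  unfolding is_block_def by (rule conjI, simp, rule disjI2, rule disjI1, rule exI[of _ I], rule exI[of _ I'], simp)

lemma is_block_vertical: "I \<noteq> {} \<Longrightarrow> ord_convex I \<Longrightarrow> is_block (I \<times> UNIV)"
  unfolding is_block_def by (rule conjI, simp, rule disjI2, rule disjI2, rule disjI1, rule exI[of _ I], simp)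

lemma is_block_horizontal: "I \<noteq> {} \<Longrightarrow> ord_convex I \<Longrightarrow> is_block (UNIV \<times> I)"
  unfolding is_block_def by (rule conjI, simp, rule disjI2, rule disjI2, rule disjI2, rule exI[of _ I], simp)

definition join :: "real \<times> real \<Rightarrow> real \<times> real \<Rightarrow> real \<times> real" where
  "join p q = (max (fst p) (fst q), max (snd p) (snd q))"

lemma le2_join [simp]: "le2 p (join p q)" "le2 q (join p q)"
  by (auto simp: join_def le2_def)

text \<open>A summand of the form \<open>k\<^bsub>J \<inter> Q\<^esub>\<close>: the generator \<open>e p\<close> and the projection \<open>\<pi> p\<close>
  describe the inclusion and the retraction; both are \<open>0\<close> outside \<open>J\<close>.\<close>

definition block_summand ::
  "('k::field \<Rightarrow> 'v::ab_group_add \<Rightarrow> 'v) \<Rightarrow> (real \<times> real) set \<Rightarrow> (real \<times> real \<Rightarrow> 'v set) \<Rightarrow>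
   (real \<times> real \<Rightarrow> real \<times> real \<Rightarrow> 'v \<Rightarrow> 'v) \<Rightarrow> (real \<times> real) set \<Rightarrow> (real \<times> real \<Rightarrow> 'v) \<Rightarrow>
   (real \<times> real \<Rightarrow> 'v \<Rightarrow> 'k) \<Rightarrow> bool" where
  "block_summand s Q V f J e \<pi> \<longleftrightarrow> is_block J \<and> J \<inter> Q \<noteq> {} \<and>
     (\<forall>p\<in>Q. e p \<in> V p \<and> (p \<notin> J \<longrightarrow> e p = 0) \<and> (p \<in> J \<longrightarrow> \<pi> p (e p) = 1) \<and>
        (\<forall>v\<in>V p. (p \<notin> J \<longrightarrow> \<pi> p v = 0) \<and> (\<forall>w\<in>V p. \<pi> p (v + w) = \<pi> p v + \<pi> p w) \<and>
           (\<forall>a. \<pi> p (s a v) = a * \<pi> p v))) \<and>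
     (\<forall>p\<in>Q. \<forall>q\<in>Q. le2 p q \<longrightarrow> (p \<in> J \<longrightarrow> f p q (e p) = e q) \<and>
        (q \<in> J \<longrightarrow> (\<forall>v\<in>V p. \<pi> q (f p q v) = \<pi> p v)))"

text \<open>Common setting for both half-planes. The assumption \<open>antidiagonal\<close> is where
  compatible lifts of finitely many elements are made: below any finite set there is a line of slope
  -1 inside \<open>Q\<close>.\<close>

locale middle_exact_module = vector_space s
  for s :: "'k::field \<Rightarrow> 'v::ab_group_add \<Rightarrow> 'v" +
  fixes Q :: "(real \<times> real) set" and V :: "real \<times> real \<Rightarrow> 'v set"
    and f :: "real \<times> real \<Rightarrow> real \<times> real \<Rightarrow> 'v \<Rightarrow> 'v"
  assumes up: "p \<in> Q \<Longrightarrow> le2 p q \<Longrightarrow> q \<in> Q"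
    and antidiagonal: "finite F \<Longrightarrow> F \<subseteq> Q \<Longrightarrow>
      \<exists>c. (\<forall>x. (x, c - x) \<in> Q) \<and> (\<forall>q\<in>F. c \<le> fst q + snd q)"
    and pers: "pers_module s Q V f"
    and fin_dim: "pointwise_fin_dim s Q V"
    and exact: "middle_exact Q V f"
begin

lemma sub: "p \<in> Q \<Longrightarrow> subspace (V p)"
  using pers by (auto simp: pers_module_def)

lemma zero_in [simp]: "p \<in> Q \<Longrightarrow> 0 \<in> V p"
  using sub subspace_0 by blast

lemma add_in: "p \<in> Q \<Longrightarrow> v \<in> V p \<Longrightarrow> w \<in> V p \<Longrightarrow> v + w \<in> V p"
  using sub subspace_add by blast

lemma diff_in: "p \<in> Q \<Longrightarrow> v \<in> V p \<Longrightarrow> w \<in> V p \<Longrightarrow> v - w \<in> V p"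
  using sub subspace_diff by blast

lemma scale_in: "p \<in> Q \<Longrightarrow> v \<in> V p \<Longrightarrow> s a v \<in> V p"
  using sub subspace_scale by blast

lemma f_in: "p \<in> Q \<Longrightarrow> le2 p q \<Longrightarrow> v \<in> V p \<Longrightarrow> f p q v \<in> V q"
  using pers up[of p q] unfolding pers_module_def by blast

lemma f_add: "p \<in> Q \<Longrightarrow> le2 p q \<Longrightarrow> v \<in> V p \<Longrightarrow> w \<in> V p \<Longrightarrow> f p q (v + w) = f p q v + f p q w"
  using pers up[of p q] unfolding pers_module_def by blast

lemma f_scale: "p \<in> Q \<Longrightarrow> le2 p q \<Longrightarrow> v \<in> V p \<Longrightarrow> f p q (s a v) = s a (f p q v)"
  using pers up[of p q] unfolding pers_module_def by blast

lemma f_zero [simp]: "p \<in> Q \<Longrightarrow> le2 p q \<Longrightarrow> f p q 0 = 0"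
  using f_add[of p q 0 0] by simp

lemma f_diff: "p \<in> Q \<Longrightarrow> le2 p q \<Longrightarrow> v \<in> V p \<Longrightarrow> w \<in> V p \<Longrightarrow> f p q (v - w) = f p q v - f p q w"
  using f_add[of p q "v - w" w] diff_in[of p v w] by simp

lemma f_id [simp]: "p \<in> Q \<Longrightarrow> v \<in> V p \<Longrightarrow> f p p v = v"
  using pers unfolding pers_module_def by blast

lemma f_comp: "p \<in> Q \<Longrightarrow> le2 p q \<Longrightarrow> le2 q r \<Longrightarrow> v \<in> V p \<Longrightarrow> f q r (f p q v) = f p r v"
  using pers up[of p q] up[of q r] unfolding pers_module_def by blast

lemma f_sum: "p \<in> Q \<Longrightarrow> le2 p q \<Longrightarrow> (\<And>i. i \<in> A \<Longrightarrow> g i \<in> V p) \<Longrightarrow>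
    f p q (\<Sum>i\<in>A. g i) = (\<Sum>i\<in>A. f p q (g i))"
  by (induction A rule: infinite_finite_induct) (auto simp: f_add sub subspace_sum)

lemma exact_lift:
  assumes "(x, y) \<in> Q" "x \<le> x'" "y \<le> y'" "u \<in> V (x, y')" "w \<in> V (x', y)"
    "f (x, y') (x', y') u = f (x', y) (x', y') w"
  obtains z where "z \<in> V (x, y)" "f (x, y) (x, y') z = u" "f (x, y) (x', y) z = w"
proof -
  have "(x, y') \<in> Q" "(x', y) \<in> Q" "(x', y') \<in> Q"
    using assms up[of "(x, y)"] by auto
  then show thesis
    using exact assms that unfolding middle_exact_def by (smt (verit) diff_self)
qed

lemma fin_dimE:
  assumes "p \<in> Q"
  obtains B where "finite B" "V p = span B"
  using fin_dim assms unfolding pointwise_fin_dim_def by metis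

lemma minimal_subspace:
  assumes "p \<in> Q" "\<C> \<noteq> {}" "\<And>C. C \<in> \<C> \<Longrightarrow> subspace C \<and> C \<subseteq> V p"
  obtains C where "C \<in> \<C>" "\<And>C'. C' \<in> \<C> \<Longrightarrow> C' \<subseteq> C \<Longrightarrow> C' = C"
  using minimal_subspace_exists fin_dimE[OF assms(1)] assms(2,3) by metis

lemma least_nonzero:
  fixes D :: "real \<Rightarrow> 'v set"
  assumes "p \<in> Q" "\<And>t. subspace (D t)" "\<And>t. D t \<subseteq> V p"
    "\<And>t u. D t \<subseteq> D u \<or> D u \<subseteq> D t" "D t0 \<noteq> {0}"
  obtains t where "D t \<noteq> {0}" "\<And>u. D u \<noteq> {0} \<Longrightarrow> D t \<subseteq> D u"
proof -
  obtain B where B: "finite B" "V p = span B" using fin_dimE assms(1) by blast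
  show thesis
    by (rule least_nonzero_subspace[of B D t0]) (use assms B that in auto)
qed

text \<open>A functional on the colimit of \<open>V\<close> over the directed set \<open>J \<inter> Q\<close>, presented as the
  finitely supported families modulo relations, gives the retraction.\<close>

lemma block_summandI:
  assumes "is_block J" "p \<in> J \<inter> Q"
    and join: "\<And>q r. q \<in> J \<inter> Q \<Longrightarrow> r \<in> J \<inter> Q \<Longrightarrow> join q r \<in> J"
    and eV: "\<And>q. q \<in> J \<inter> Q \<Longrightarrow> e q \<in> V q"
    and ef: "\<And>q r. q \<in> J \<inter> Q \<Longrightarrow> r \<in> Q \<Longrightarrow> le2 q r \<Longrightarrow> f q r (e q) = (if r \<in> J then e r else 0)"
    and L: "\<And>r. r \<in> J \<inter> Q \<Longrightarrow> subspace (L r)"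
    and L_out: "\<And>q r v. q \<in> Q - J \<Longrightarrow> r \<in> J \<Longrightarrow> le2 q r \<Longrightarrow> v \<in> V q \<Longrightarrow> f q r v \<in> L r"
    and L_f: "\<And>q r v. q \<in> J \<inter> Q \<Longrightarrow> r \<in> J \<Longrightarrow> le2 q r \<Longrightarrow> v \<in> L q \<Longrightarrow> f q r v \<in> L r"
    and LV: "\<And>r. r \<in> J \<inter> Q \<Longrightarrow> L r \<subseteq> V r"
    and eL: "\<And>r. r \<in> J \<inter> Q \<Longrightarrow> e r \<notin> L r"
  shows "\<exists>e' \<pi>. block_summand s Q V f J e' \<pi>"
proof -
  interpret F: vector_space "\<lambda>a (c :: real \<times> real \<Rightarrow> 'v) i. s a (c i)"
    by (rule vector_space_fun) (rule vector_space_axioms)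
  \<comment> \<open>\<open>W A r c\<close> certifies that the family \<open>c\<close>, supported in
    \<open>A\<close>, becomes zero in the colimit of the quotients of \<open>V q\<close> by
    \<open>L q\<close>: pushed to a common bound \<open>r\<close>, its entries add up to an element
    of \<open>L r\<close>. So \<open>R\<close> is the kernel of the map from families to that
    colimit.\<close>
  define W where "W A r c \<longleftrightarrow> finite A \<and> A \<subseteq> J \<inter> Q \<and> r \<in> J \<inter> Q \<and>
    (\<forall>q\<in>A. le2 q r \<and> c q \<in> V q) \<and> (\<forall>q. q \<notin> A \<longrightarrow> c q = 0) \<and> (\<Sum>q\<in>A. f q r (c q)) \<in> L r"
    for A r and c :: "real \<times> real \<Rightarrow> 'v"
  define R where "R = {c. \<exists>A r. W A r c}"
  \<comment> \<open>Certificates survive enlarging \<open>A\<close> and \<open>r\<close>, so that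
    two of them can be brought to a common bound, which exists because \<open>J\<close> is closed
    under joins.\<close>
  have W_mono: "W A' r' c" if W: "W A r c" and A': "finite A'" "A \<subseteq> A'" "A' \<subseteq> J \<inter> Q"
    and r': "r' \<in> J \<inter> Q" "le2 r r'" "\<And>q. q \<in> A' \<Longrightarrow> le2 q r'" for A A' r r' c
  proof -
    have cV: "c q \<in> V q" if "q \<in> A'" for q
      using W A' that by (cases "q \<in> A") (auto simp: W_def)
    have "(\<Sum>q\<in>A'. f q r' (c q)) = (\<Sum>q\<in>A. f q r' (c q))"
      using W A' r' by (intro sum.mono_neutral_right) (auto simp: W_def)
    also have "\<dots> = (\<Sum>q\<in>A. f r r' (f q r (c q)))"
      using W r' by (intro sum.cong) (auto simp: W_def f_comp)
    also have "\<dots> = f r r' (\<Sum>q\<in>A. f q r (c q))"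
      using W r' by (intro f_sum[symmetric]) (auto simp: W_def f_in)
    also have "\<dots> \<in> L r'" using W r' by (auto simp: W_def L_f)
    finally show ?thesis
      using W A' r' cV by (auto simp: W_def)
  qed
  have "F.subspace R"
    unfolding F.subspace_def
  proof (intro conjI allI ballI)
    have "W {} p 0"
      using assms(2) L[OF assms(2)] by (auto simp: W_def subspace_0)
    then show "0 \<in> R" by (auto simp: R_def)
  next
    fix c d assume "c \<in> R" "d \<in> R"
    then obtain A r B r' where c: "W A r c" and d: "W B r' d" by (auto simp: R_def)
    let ?r = "join r r'"
    have rJ: "?r \<in> J \<inter> Q" using c d join up[of r ?r] by (auto simp: W_def)
    have le: "le2 q ?r" if "q \<in> A \<union> B" for q
      using that c d le2_join[of r r'] le2_join(2)[of r' r] le2_trans[of q] unfolding W_def by blast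
    have c': "W (A \<union> B) ?r c" by (rule W_mono[OF c]) (use c d rJ le in \<open>auto simp: W_def\<close>)
    have d': "W (A \<union> B) ?r d" by (rule W_mono[OF d]) (use c d rJ le in \<open>auto simp: W_def\<close>)
    have "(\<Sum>q\<in>A \<union> B. f q ?r ((c + d) q)) = (\<Sum>q\<in>A \<union> B. f q ?r (c q)) + (\<Sum>q\<in>A \<union> B. f q ?r (d q))"
      unfolding sum.distrib[symmetric]
      by (rule sum.cong) (use c' d' in \<open>auto simp: W_def intro!: f_add\<close>)
    also have "\<dots> \<in> L ?r" using c' d' L[OF rJ] by (auto simp: W_def intro!: subspace_add)
    finally have "W (A \<union> B) ?r (c + d)"
      using c' d' unfolding W_def by (auto intro!: add_in)
    then show "c + d \<in> R" by (auto simp: R_def)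
  next
    fix a c assume "c \<in> R"
    then obtain A r where c: "W A r c" by (auto simp: R_def)
    have "(\<Sum>q\<in>A. f q r (s a (c q))) = s a (\<Sum>q\<in>A. f q r (c q))"
      unfolding scale_sum_right
      by (rule sum.cong) (use c in \<open>auto simp: W_def intro!: f_scale\<close>)
    also have "\<dots> \<in> L r" using c L[of r] by (auto simp: W_def intro!: subspace_scale)
    finally have "W A r (\<lambda>q. s a (c q))"
      using c unfolding W_def by (auto intro!: scale_in)
    then show "(\<lambda>q. s a (c q)) \<in> R" by (auto simp: R_def)
  qed
  moreover
  define \<delta> where "\<delta> q v = (\<lambda>i. if i = q then v else 0)" for q :: "real \<times> real" and v :: 'v
  \<comment> \<open>At any bound \<open>r\<close> the generator is represented by
    \<open>e r\<close>, which \<open>eL\<close> keeps out of \<open>L r\<close>; its class in the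
    colimit is therefore nonzero.\<close>
  have "\<delta> p (e p) \<notin> R"
  proof
    assume "\<delta> p (e p) \<in> R"
    then obtain A r where W: "W A r (\<delta> p (e p))" by (auto simp: R_def)
    have pA: "p \<in> A"
    proof (rule ccontr)
      assume "p \<notin> A"
      then have "e p = 0" using W by (auto simp: W_def \<delta>_def split: if_splits)
      then show False using eL[OF assms(2)] L[OF assms(2)] subspace_0 by auto
    qed
    have "(\<Sum>q\<in>A. f q r (\<delta> p (e p) q)) = (\<Sum>q\<in>{p}. f q r (\<delta> p (e p) q))"
      by (rule sum.mono_neutral_right) (use W pA in \<open>auto simp: W_def \<delta>_def\<close>)
    also have "\<dots> = e r" using ef[of p r] W pA by (auto simp: \<delta>_def W_def)
    finally show False using eL[of r] W by (simp add: W_def)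
  qed
  ultimately obtain \<phi> where lin: "Vector_Spaces.linear (\<lambda>a c i. s a (c i)) (*) \<phi>"
    and \<phi>1: "\<phi> (\<delta> p (e p)) = 1" and \<phi>0: "\<And>c. c \<in> R \<Longrightarrow> \<phi> c = 0"
    by (rule F.separating_functional) blast
  interpret lin: Vector_Spaces.linear "\<lambda>a (c :: real \<times> real \<Rightarrow> 'v) i. s a (c i)" "(*)" \<phi> by (rule lin)
  have \<delta>_add: "\<delta> q (v + w) = \<delta> q v + \<delta> q w" for q v w by (auto simp: \<delta>_def)
  have \<delta>_scale: "\<delta> q (s a v) = (\<lambda>i. s a (\<delta> q v i))" for q a v by (auto simp: \<delta>_def)
  have L_zero: "\<phi> (\<delta> q v) = 0" if "q \<in> J \<inter> Q" "v \<in> L q" for q v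
  proof (rule \<phi>0)
    have "v \<in> V q" using LV[OF that(1)] that(2) by blast
    then have "W {q} q (\<delta> q v)" using that by (auto simp: W_def \<delta>_def)
    then show "\<delta> q v \<in> R" by (auto simp: R_def)
  qed
  \<comment> \<open>The family with \<open>v\<close> at \<open>q\<close> and minus its image at
    \<open>r\<close> is a relation. For \<open>q = r\<close> the two entries would sit at the same
    place, hence the case distinction.\<close>
  have nat: "\<phi> (\<delta> r (f q r v)) = \<phi> (\<delta> q v)" if "q \<in> J \<inter> Q" "r \<in> J" "le2 q r" "v \<in> V q" for q r v
  proof (cases "q = r")
    case False
    let ?c = "\<delta> q v + \<delta> r (s (-1) (f q r v))"
    have r: "r \<in> Q" using that up by blast
    have "f r r (s (-1) (f q r v)) = s (-1) (f q r v)"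
      using r that by (intro f_id scale_in f_in) auto
    then have "(\<Sum>i\<in>{q, r}. f i r (?c i)) = 0"
      using False that r by (simp add: \<delta>_def f_id f_in)
    then have "W {q, r} r ?c"
      using that r L[of r] False by (auto simp: W_def \<delta>_def subspace_0 f_in scale_in subspace_neg sub)
    then have "\<phi> ?c = 0" using \<phi>0 by (auto simp: R_def)
    then show ?thesis unfolding \<delta>_scale lin.add lin.scale by simp
  qed (use that in simp)
  define e' where "e' q = (if q \<in> J then e q else 0)" for q
  define \<pi> where "\<pi> q v = (if q \<in> J then \<phi> (\<delta> q v) else 0)" for q v
  \<comment> \<open>If \<open>q\<close> lies outside \<open>J\<close>, the image lands in
    \<open>L r\<close> by \<open>L_out\<close>, where the functional vanishes, in accordance with
    \<open>\<pi> q v = 0\<close>.\<close>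
  have \<pi>_nat: "\<pi> r (f q r v) = \<pi> q v" if "q \<in> Q" "r \<in> Q" "le2 q r" "r \<in> J" "v \<in> V q" for q r v
    using that nat[of q r v] L_out[of q r v] L_zero[of r "f q r v"] by (auto simp: \<pi>_def)
  \<comment> \<open>The normalisation was made at \<open>p\<close> only; it reaches any other point
    of \<open>J\<close> through the join with \<open>p\<close>.\<close>
  have \<pi>_one: "\<pi> q (e' q) = 1" if q: "q \<in> J \<inter> Q" for q
  proof -
    let ?r = "join p q"
    have r: "?r \<in> J \<inter> Q" using join[OF assms(2) q] up[of q ?r] q by auto
    have "\<phi> (\<delta> ?r (e ?r)) = \<phi> (\<delta> p (e p))"
      using nat[OF assms(2), of ?r "e p"] ef[OF assms(2), of ?r] r eV[OF assms(2)] by auto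
    moreover have "\<phi> (\<delta> ?r (e ?r)) = \<phi> (\<delta> q (e q))"
      using nat[OF q, of ?r "e q"] ef[OF q, of ?r] r eV[OF q] by auto
    ultimately show ?thesis using q \<phi>1 by (simp add: \<pi>_def e'_def)
  qed
  have "block_summand s Q V f J e' \<pi>"
    unfolding block_summand_def
  proof (intro conjI ballI impI allI)
    fix q assume "q \<in> Q"
    then show "e' q \<in> V q" using eV[of q] by (simp add: e'_def)
  next
    fix q r assume "q \<in> Q" "r \<in> Q" "le2 q r" "q \<in> J"
    then show "f q r (e' q) = e' r" using ef[of q r] by (simp add: e'_def)
  qed (use assms(1,2) \<pi>_nat \<pi>_one in \<open>auto simp: e'_def \<pi>_def \<delta>_add \<delta>_scale lin.add lin.scale\<close>)
  then show ?thesis by blast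
qed

section \<open>Coherent families\<close>

text \<open>The elements of the limit over \<open>F\<close> whose values lie in \<open>S\<close>;
  closure of \<open>S\<close> under the structure maps is not part of it.\<close>

definition coherent :: "(real \<times> real \<Rightarrow> 'v set) \<Rightarrow> (real \<times> real) set \<Rightarrow> (real \<times> real \<Rightarrow> 'v) \<Rightarrow> bool" where
  "coherent S F e \<longleftrightarrow> (\<forall>q\<in>F. e q \<in> S q) \<and> (\<forall>q\<in>F. \<forall>r\<in>F. le2 q r \<longrightarrow> f q r (e q) = e r)"

lemma coherent_mono: "coherent S F e \<Longrightarrow> F' \<subseteq> F \<Longrightarrow> coherent S F' e"
  unfolding coherent_def by (meson subsetD)

context
  fixes S :: "real \<times> real \<Rightarrow> 'v set" and P :: "(real \<times> real) set"
  assumes PQ: "P \<subseteq> Q" and S: "\<And>q. q \<in> P \<Longrightarrow> subspace (S q)" "\<And>q. q \<in> P \<Longrightarrow> S q \<subseteq> V q"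
begin

lemma coherent_add: "F \<subseteq> P \<Longrightarrow> coherent S F e \<Longrightarrow> coherent S F e' \<Longrightarrow> coherent S F (\<lambda>q. e q + e' q)"
  unfolding coherent_def using PQ S
  by (smt (verit) f_add subsetD subspace_add)

lemma coherent_diff: "F \<subseteq> P \<Longrightarrow> coherent S F e \<Longrightarrow> coherent S F e' \<Longrightarrow> coherent S F (\<lambda>q. e q - e' q)"
  unfolding coherent_def using PQ S
  by (smt (verit) f_diff subsetD subspace_diff)

lemma coherent_scale: "F \<subseteq> P \<Longrightarrow> coherent S F e \<Longrightarrow> coherent S F (\<lambda>q. s a (e q))"
  unfolding coherent_def using PQ S
  by (smt (verit) f_scale subsetD subspace_scale)

lemma coherent_zero: "F \<subseteq> P \<Longrightarrow> coherent S F (\<lambda>q. 0)"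
  unfolding coherent_def using PQ S by (auto simp: subspace_0 subset_iff)

text \<open>Linear compactness: a partial assignment that extends coherently over every finite set
  can be enlarged by any further point, since the possible values there form a descending family
  of affine subspaces of a finite-dimensional space.\<close>

lemma coherent_extend_point:
  assumes q0: "q0 \<in> P" and gP: "fst ` g \<subseteq> P"
    and g: "\<And>F. finite F \<Longrightarrow> F \<subseteq> P \<Longrightarrow> \<exists>e. coherent S F e \<and> (\<forall>q v. (q, v) \<in> g \<longrightarrow> q \<in> F \<longrightarrow> e q = v)"
  obtains v where "\<And>F. finite F \<Longrightarrow> F \<subseteq> P \<Longrightarrow>
    \<exists>e. coherent S F e \<and> (\<forall>q w. (q, w) \<in> insert (q0, v) g \<longrightarrow> q \<in> F \<longrightarrow> e q = w)"
proof -
  \<comment> \<open>The direction space of the possible values at \<open>q0\<close>: differences of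
    two coherent extensions of \<open>g\<close> over \<open>insert q0 F\<close> vanish wherever
    \<open>g\<close> prescribes a value.\<close>
  define W where "W F = {e q0 |e. coherent S (insert q0 F) e \<and> (\<forall>q v. (q, v) \<in> g \<longrightarrow> q \<in> insert q0 F \<longrightarrow> e q = 0)}" for F
  have WI: "x \<in> W F" if "coherent S (insert q0 F) e" "\<forall>q v. (q, v) \<in> g \<longrightarrow> q \<in> insert q0 F \<longrightarrow> e q = 0" "x = e q0" for F e x
    unfolding W_def using that by blast
  have W_sub: "subspace (W F) \<and> W F \<subseteq> V q0" if F: "F \<subseteq> P" for F
  proof -
    have F': "insert q0 F \<subseteq> P" using F q0 by simp
    have "0 \<in> W F" by (rule WI[OF coherent_zero[OF F']]) auto
    moreover have "x + y \<in> W F" if xy: "x \<in> W F" "y \<in> W F" for x y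
    proof -
      obtain d e where de: "coherent S (insert q0 F) d" "\<forall>q v. (q, v) \<in> g \<longrightarrow> q \<in> insert q0 F \<longrightarrow> d q = 0" "x = d q0"
        "coherent S (insert q0 F) e" "\<forall>q v. (q, v) \<in> g \<longrightarrow> q \<in> insert q0 F \<longrightarrow> e q = 0" "y = e q0"
        using xy unfolding W_def by blast
      have "\<forall>q v. (q, v) \<in> g \<longrightarrow> q \<in> insert q0 F \<longrightarrow> d q + e q = 0" using de(2,5) by fastforce
      then show ?thesis using WI[OF coherent_add[OF F' de(1,4)]] de(3,6) by simp
    qed
    moreover have "s a x \<in> W F" if x: "x \<in> W F" for a x
    proof -
      obtain d where d: "coherent S (insert q0 F) d" "\<forall>q v. (q, v) \<in> g \<longrightarrow> q \<in> insert q0 F \<longrightarrow> d q = 0" "x = d q0"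
        using x unfolding W_def by blast
      have "\<forall>q v. (q, v) \<in> g \<longrightarrow> q \<in> insert q0 F \<longrightarrow> s a (d q) = 0" using d(2) by fastforce
      then show ?thesis using WI[OF coherent_scale[OF F' d(1), of a]] d(3) by simp
    qed
    moreover have "W F \<subseteq> V q0" unfolding W_def coherent_def using S(2)[OF q0] by auto
    ultimately show ?thesis by (auto intro: subspaceI)
  qed
  have W_mono: "W F' \<subseteq> W F" if "F \<subseteq> F'" for F F'
  proof
    fix x assume "x \<in> W F'"
    then obtain e where e: "x = e q0" "coherent S (insert q0 F') e" "\<forall>q v. (q, v) \<in> g \<longrightarrow> q \<in> insert q0 F' \<longrightarrow> e q = 0"
      unfolding W_def by blast
    have "coherent S (insert q0 F) e" using e(2) by (rule coherent_mono) (use that in blast)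
    moreover have "\<forall>q v. (q, v) \<in> g \<longrightarrow> q \<in> insert q0 F \<longrightarrow> e q = 0" using e(3) that by blast
    ultimately show "x \<in> W F" using e(1) by (rule WI)
  qed
  obtain C where C: "C \<in> {W F |F. finite F \<and> F \<subseteq> P}"
    "\<And>C'. C' \<in> {W F |F. finite F \<and> F \<subseteq> P} \<Longrightarrow> C' \<subseteq> C \<Longrightarrow> C' = C"
  proof (rule minimal_subspace[of q0 "{W F |F. finite F \<and> F \<subseteq> P}"])
    show "{W F |F. finite F \<and> F \<subseteq> P} \<noteq> {}" by blast
  qed (use W_sub q0 PQ in \<open>auto simp del: insert_iff\<close>)
  then obtain F0 where F0: "finite F0" "F0 \<subseteq> P" "C = W F0" by blast
  \<comment> \<open>The spaces shrink as \<open>F\<close> grows, so from the minimal one at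
    \<open>F0\<close> onwards they are constant.\<close>
  have least: "W (F0 \<union> F) = W F0" if "finite F" "F \<subseteq> P" for F
  proof (rule C(2)[unfolded F0(3)])
    show "W (F0 \<union> F) \<in> {W F |F. finite F \<and> F \<subseteq> P}" using F0 that by blast
  qed (rule W_mono, simp)
  obtain e0 where e0: "coherent S (insert q0 F0) e0" "\<forall>q v. (q, v) \<in> g \<longrightarrow> q \<in> insert q0 F0 \<longrightarrow> e0 q = v"
    using g[of "insert q0 F0"] F0 q0 by auto
  have "\<exists>e. coherent S F e \<and> (\<forall>q v. (q, v) \<in> insert (q0, e0 q0) g \<longrightarrow> q \<in> F \<longrightarrow> e q = v)"
    if F: "finite F" "F \<subseteq> P" for F
  proof -
    let ?G = "insert q0 (F0 \<union> F)"
    have GP: "?G \<subseteq> P" using F F0 q0 by simp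
    obtain e1 where e1: "coherent S ?G e1" "\<forall>q v. (q, v) \<in> g \<longrightarrow> q \<in> ?G \<longrightarrow> e1 q = v"
      using g[of ?G] F F0 GP by auto
    have "coherent S (insert q0 F0) e1" using e1(1) by (rule coherent_mono) blast
    then have "coherent S (insert q0 F0) (\<lambda>q. e0 q - e1 q)"
      using coherent_diff[OF _ e0(1)] GP by simp
    moreover have "\<forall>q v. (q, v) \<in> g \<longrightarrow> q \<in> insert q0 F0 \<longrightarrow> e0 q - e1 q = 0"
      using e0(2) e1(2) by fastforce
    \<comment> \<open>The error of \<open>e1\<close> at \<open>q0\<close> is a direction over
      \<open>F0\<close>, hence also over the larger set, where some \<open>h\<close> realises it
      without disturbing the values of \<open>g\<close>.\<close>
    ultimately have "e0 q0 - e1 q0 \<in> W F0" by (rule WI) simp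
    then have "e0 q0 - e1 q0 \<in> W (F0 \<union> F)" using least[OF F] by simp
    then obtain h where h: "coherent S ?G h" "\<forall>q v. (q, v) \<in> g \<longrightarrow> q \<in> ?G \<longrightarrow> h q = 0" "e0 q0 - e1 q0 = h q0"
      unfolding W_def by blast
    have "coherent S F (\<lambda>q. e1 q + h q)"
      using coherent_add[OF GP e1(1) h(1)] by (rule coherent_mono) blast
    moreover have "\<forall>q v. (q, v) \<in> insert (q0, e0 q0) g \<longrightarrow> q \<in> F \<longrightarrow> e1 q + h q = v"
      using e1(2) h(2) h(3)[symmetric] by fastforce
    ultimately show ?thesis by blast
  qed
  then show thesis by (rule that)
qed

text \<open>The limit over \<open>P\<close> has an element through \<open>m\<close> as soon as this
  is so over every finite set. A maximal partial assignment that extends over all finite sets must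
  be total, since \<open>coherent_extend_point\<close> would enlarge it otherwise.\<close>

lemma coherent_exists:
  assumes p: "p \<in> P"
    and fin: "\<And>F. finite F \<Longrightarrow> F \<subseteq> P \<Longrightarrow> p \<in> F \<Longrightarrow> \<exists>e. coherent S F e \<and> e p = m"
  obtains e where "coherent S P e" "e p = m"
proof -
  define ext where "ext g F e \<longleftrightarrow> coherent S F e \<and> (\<forall>q v. (q, v) \<in> g \<longrightarrow> q \<in> F \<longrightarrow> e q = v)"
    for g F and e :: "real \<times> real \<Rightarrow> 'v"
  \<comment> \<open>Partial assignments are kept as relations: being single-valued follows from
    extendability over one-point sets.\<close>
  define \<G> where "\<G> = {g. (p, m) \<in> g \<and> fst ` g \<subseteq> P \<and> (\<forall>F. finite F \<longrightarrow> F \<subseteq> P \<longrightarrow> (\<exists>e. ext g F e))}"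
  have \<G>_ext: "\<exists>e. ext g F e" if "g \<in> \<G>" "finite F" "F \<subseteq> P" for g F
    using that unfolding \<G>_def by blast
  have "{(p, m)} \<in> \<G>"
  proof -
    have "\<exists>e. ext {(p, m)} F e" if F: "finite F" "F \<subseteq> P" for F
    proof -
      obtain e where e: "coherent S (insert p F) e" "e p = m"
        using fin[of "insert p F"] F p by auto
      from e(1) have "coherent S F e" by (rule coherent_mono) blast
      then show ?thesis using e(2) by (auto simp: ext_def)
    qed
    then show ?thesis using p by (simp add: \<G>_def)
  qed
  then have "\<G> \<noteq> {}" by blast
  then have "\<exists>M\<in>\<G>. \<forall>X\<in>\<G>. M \<subseteq> X \<longrightarrow> X = M"
  proof (rule subset_Zorn_nonempty)
    fix \<C> assume ne: "\<C> \<noteq> {}" and ch: "subset.chain \<G> \<C>"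
    have CG: "\<C> \<subseteq> \<G>" using ch by (simp add: subset.chain_def)
    have uniq: "v = v'" if vv: "(q, v) \<in> \<Union>\<C>" "(q, v') \<in> \<Union>\<C>" for q v v'
    proof -
      obtain g where g: "g \<in> \<C>" "{(q, v), (q, v')} \<subseteq> g"
        by (rule finite_subset_Union_chain[OF _ _ ne ch, of "{(q, v), (q, v')}"]) (use vv in auto)
      then have gG: "g \<in> \<G>" using CG by blast
      then have "q \<in> P" using g by (force simp: \<G>_def)
      then obtain e where "ext g {q} e" using \<G>_ext[OF gG, of "{q}"] by auto
      then show ?thesis using g by (auto simp: ext_def)
    qed
    \<comment> \<open>Only finitely many pairs of the union have their first entry in
      \<open>F\<close>, so one member of the chain already contains them all.\<close>
    have "\<exists>e. ext (\<Union>\<C>) F e" if F: "finite F" "F \<subseteq> P" for F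
    proof -
      let ?A = "{z \<in> \<Union>\<C>. fst z \<in> F}"
      have "inj_on fst ?A" using uniq by (metis (no_types, lifting) inj_onI mem_Collect_eq prod.collapse)
      moreover have "finite (fst ` ?A)" using F(1) by (rule rev_finite_subset) blast
      ultimately have "finite ?A" by (rule finite_imageD[rotated])
      then obtain g where g: "g \<in> \<C>" "?A \<subseteq> g"
        by (rule finite_subset_Union_chain[OF _ _ ne ch]) auto
      then obtain e where "ext g F e" using CG F \<G>_ext by blast
      then have "ext (\<Union>\<C>) F e" using g(2) by (fastforce simp: ext_def)
      then show ?thesis by blast
    qed
    moreover have "(p, m) \<in> \<Union>\<C>" "fst ` \<Union>\<C> \<subseteq> P" using ne CG by (auto simp: \<G>_def)
    ultimately show "\<Union>\<C> \<in> \<G>" by (simp add: \<G>_def)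
  qed
  then obtain g where g: "g \<in> \<G>" and max: "\<And>g'. g' \<in> \<G> \<Longrightarrow> g \<subseteq> g' \<Longrightarrow> g' = g" by blast
  have gP: "fst ` g \<subseteq> P" and pm: "(p, m) \<in> g" using g by (auto simp: \<G>_def)
  note g_ext = \<G>_ext[OF g]
  have total: "\<exists>v. (q, v) \<in> g" if q: "q \<in> P" for q
  proof -
    obtain v where v: "\<And>F. finite F \<Longrightarrow> F \<subseteq> P \<Longrightarrow> \<exists>e. ext (insert (q, v) g) F e"
      unfolding ext_def
      by (rule coherent_extend_point[OF q gP]) (use g_ext[unfolded ext_def] in blast)+
    then have "insert (q, v) g \<in> \<G>" using g q by (simp add: \<G>_def)
    then have "insert (q, v) g = g" by (rule max) blast
    then show ?thesis by blast
  qed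
  define e where "e q = (SOME v. (q, v) \<in> g)" for q
  have e: "(q, e q) \<in> g" if "q \<in> P" for q
    unfolding e_def using total[OF that] by (rule someI_ex)
  have "coherent S P e"
    unfolding coherent_def
  proof (intro conjI ballI impI)
    fix q r assume qr: "q \<in> P" "r \<in> P" "le2 q r"
    obtain d where d: "ext g {q, r} d" using g_ext[of "{q, r}"] qr by auto
    then have "d q = e q" "d r = e r" using e[of q] e[of r] qr by (auto simp: ext_def)
    then show "f q r (e q) = e r" using d qr by (auto simp: ext_def coherent_def)
  next
    fix q assume q: "q \<in> P"
    obtain d where d: "ext g {q} d" using g_ext[of "{q}"] q by auto
    then have "d q = e q" using e[OF q] by (auto simp: ext_def)
    then show "e q \<in> S q" using d by (auto simp: ext_def coherent_def)
  qed
  moreover have "e p = m"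
  proof -
    obtain d where d: "ext g {p} d" using g_ext[of "{p}"] p by auto
    then show ?thesis using e[OF p] pm by (metis ext_def singletonI)
  qed
  ultimately show thesis by (rule that)
qed

end

end

section \<open>Death blocks\<close>

abbreviation swap_maps :: "(real \<times> real \<Rightarrow> real \<times> real \<Rightarrow> 'v \<Rightarrow> 'v) \<Rightarrow> real \<times> real \<Rightarrow> real \<times> real \<Rightarrow> 'v \<Rightarrow> 'v" where
  "swap_maps f \<equiv> \<lambda>p q. f (prod.swap p) (prod.swap q)"

lemma le2_swap [simp]: "le2 (prod.swap p) (prod.swap q) \<longleftrightarrow> le2 p q"
  by (auto simp: le2_def)

text \<open>Each new largest point gets a value related to that of the previous largest point;
  transitivity relates it to all earlier ones. The relation is kept abstract so that the lemma can
  also be applied with the order reversed.\<close>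

lemma finite_chain_choice:
  fixes A :: "'a::linorder \<Rightarrow> 'b set" and R :: "'a \<Rightarrow> 'a \<Rightarrow> 'b \<Rightarrow> 'b \<Rightarrow> bool"
  assumes "finite X" "\<And>x. x \<in> X \<Longrightarrow> a \<le> x" "v \<in> A a"
    and step: "\<And>x y u. x \<le> y \<Longrightarrow> u \<in> A x \<Longrightarrow> \<exists>w\<in>A y. R x y u w"
    and trans: "\<And>x y z u v w. x \<le> y \<Longrightarrow> y \<le> z \<Longrightarrow> u \<in> A x \<Longrightarrow> v \<in> A y \<Longrightarrow> w \<in> A z \<Longrightarrow>
      R x y u v \<Longrightarrow> R y z v w \<Longrightarrow> R x z u w"
    and refl: "\<And>x u. u \<in> A x \<Longrightarrow> R x x u u"
  shows "\<exists>g. g a = v \<and> (\<forall>x\<in>insert a X. g x \<in> A x) \<and>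
    (\<forall>x\<in>insert a X. \<forall>y\<in>insert a X. x \<le> y \<longrightarrow> R x y (g x) (g y))"
  using assms(1,2)
proof (induction X rule: finite_linorder_max_induct)
  case empty
  show ?case using assms(3) refl by (intro exI[of _ "\<lambda>_. v"]) simp
next
  case (insert b X)
  then obtain g where "g a = v \<and> (\<forall>x\<in>insert a X. g x \<in> A x) \<and>
      (\<forall>x\<in>insert a X. \<forall>y\<in>insert a X. x \<le> y \<longrightarrow> R x y (g x) (g y))" by auto
  then have g: "g a = v" "\<And>x. x \<in> insert a X \<Longrightarrow> g x \<in> A x"
    "\<And>x y. x \<in> insert a X \<Longrightarrow> y \<in> insert a X \<Longrightarrow> x \<le> y \<Longrightarrow> R x y (g x) (g y)" by blast+
  show ?case
  proof (cases "b = a")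
    case True
    then show ?thesis using g by (intro exI[of _ g]) auto
  next
    case False
    then have ab: "a < b" using insert.prems[of b] by auto
    define m where "m = Max (insert a X)"
    have m: "m \<in> insert a X" "\<And>x. x \<in> insert a X \<Longrightarrow> x \<le> m"
      unfolding m_def using Max_in[of "insert a X"] Max_ge[of "insert a X"] insert.hyps(1) by blast+
    have mb: "m < b" using m(1) ab insert.hyps(2) by auto
    obtain w where w: "w \<in> A b" "R m b (g m) w" using step[OF less_imp_le[OF mb] g(2)[OF m(1)]] by blast
    have Rb: "R x b (g x) w" if "x \<in> insert a X" for x
      using trans[OF m(2)[OF that] less_imp_le[OF mb] g(2)[OF that] g(2)[OF m(1)] w(1) g(3)[OF that m(1) m(2)[OF that]] w(2)] .
    have nb: "x \<noteq> b" "\<not> b \<le> x" if "x \<in> insert a X" for x using m(2)[OF that] mb by auto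
    show ?thesis
      using g w Rb nb refl[OF w(1)] ab by (intro exI[of _ "g(b := w)"]) (auto 4 3)
  qed
qed

definition dying :: "(real \<times> real) set \<Rightarrow> (real \<times> real \<Rightarrow> 'v::ab_group_add set) \<Rightarrow>
   (real \<times> real \<Rightarrow> real \<times> real \<Rightarrow> 'v \<Rightarrow> 'v) \<Rightarrow> (real \<times> real) set \<Rightarrow> real \<times> real \<Rightarrow> 'v set" where
  "dying Q V f J q = {v \<in> V q. \<forall>r\<in>Q. le2 q r \<longrightarrow> r \<notin> J \<longrightarrow> f q r v = 0}"

section \<open>Transposition of the plane, and lifting of dying elements\<close>

lemma dying_swap:
  "dying (prod.swap -` Q) (V \<circ> prod.swap) (swap_maps f) (prod.swap -` J) q = dying Q V f J (prod.swap q)"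
proof -
  have "(\<forall>r\<in>prod.swap -` Q. le2 q r \<longrightarrow> r \<notin> prod.swap -` J \<longrightarrow> swap_maps f q r v = 0) \<longleftrightarrow>
        (\<forall>r\<in>Q. le2 (prod.swap q) r \<longrightarrow> r \<notin> J \<longrightarrow> f (prod.swap q) r v = 0)" for v
    by (metis (no_types, lifting) le2_swap swap_swap vimage_eq)
  then show ?thesis by (simp add: dying_def)
qed

context middle_exact_module
begin

text \<open>Transposing a square exchanges the two middle corners, which changes only the sign of
  the difference. An antidiagonal is its own transpose, because
  \<open>c - (c - x) = x\<close>.\<close>

lemma swap_module: "middle_exact_module s (prod.swap -` Q) (V \<circ> prod.swap) (swap_maps f)"
proof unfold_locales
  show "q \<in> prod.swap -` Q" if "p \<in> prod.swap -` Q" "le2 p q" for p q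
    using that up[of "prod.swap p" "prod.swap q"] by simp
next
  fix F assume F: "finite F" "F \<subseteq> prod.swap -` Q"
  obtain c where c: "\<forall>x. (x, c - x) \<in> Q" "\<forall>q\<in>prod.swap ` F. c \<le> fst q + snd q"
    using antidiagonal[of "prod.swap ` F"] F by (metis finite_imageI image_subset_iff_subset_vimage)
  have "(c - x, c - (c - x)) \<in> Q" for x using c(1) by blast
  then show "\<exists>c. (\<forall>x. (x, c - x) \<in> prod.swap -` Q) \<and> (\<forall>q\<in>F. c \<le> fst q + snd q)"
    using c(2) by (intro exI[of _ c]) (auto simp: add.commute)
next
  show "pers_module s (prod.swap -` Q) (V \<circ> prod.swap) (swap_maps f)"
    unfolding pers_module_def
    using vector_space_axioms
    by (auto simp: sub f_in f_add f_scale f_comp simp del: swap_simp)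
  show "pointwise_fin_dim s (prod.swap -` Q) (V \<circ> prod.swap)"
    using fin_dim by (auto simp: pointwise_fin_dim_def)
  show "middle_exact (prod.swap -` Q) (V \<circ> prod.swap) (swap_maps f)"
    unfolding middle_exact_def
  proof (intro allI impI ballI)
    fix x x' y y' u w
    assume *: "x \<le> x' \<and> y \<le> y' \<and> (x, y) \<in> prod.swap -` Q \<and> (x, y') \<in> prod.swap -` Q \<and>
       (x', y) \<in> prod.swap -` Q \<and> (x', y') \<in> prod.swap -` Q"
      and u: "u \<in> (V \<circ> prod.swap) (x, y')" and w: "w \<in> (V \<circ> prod.swap) (x', y)"
    have "f (y, x') (y', x') w - f (y', x) (y', x') u = 0 \<longleftrightarrow>
      (\<exists>z\<in>V (y, x). f (y, x) (y, x') z = w \<and> f (y, x) (y', x) z = u)"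
      using exact * u w unfolding middle_exact_def by auto
    then show "(swap_maps f (x, y') (x', y') u - swap_maps f (x', y) (x', y') w = 0) =
       (\<exists>z\<in>(V \<circ> prod.swap) (x, y). swap_maps f (x, y) (x, y') z = u \<and> swap_maps f (x, y) (x', y) z = w)"
      by auto
  qed
qed

definition ker :: "real \<times> real \<Rightarrow> real \<times> real \<Rightarrow> 'v set" where
  "ker p q = {v \<in> V p. f p q v = 0}"

lemma ker_subspace: "p \<in> Q \<Longrightarrow> le2 p q \<Longrightarrow> subspace (ker p q)"
  by (rule subspaceI) (auto simp: ker_def add_in scale_in f_add f_scale)

lemma ker_mono: "p \<in> Q \<Longrightarrow> le2 p q \<Longrightarrow> le2 q r \<Longrightarrow> ker p q \<subseteq> ker p r"
  using up[of p q] by (auto simp: ker_def f_comp[symmetric, of p q r])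

lemma ker_sub: "ker p q \<subseteq> V p"
  by (auto simp: ker_def)

lemma dying_subspace: "q \<in> Q \<Longrightarrow> subspace (dying Q V f J q)"
  by (rule subspaceI) (auto simp: dying_def add_in scale_in f_add f_scale)

lemma dying_sub: "dying Q V f J q \<subseteq> V q"
  by (auto simp: dying_def)

lemma dying_f: "q \<in> Q \<Longrightarrow> le2 q r \<Longrightarrow> v \<in> dying Q V f J q \<Longrightarrow> f q r v \<in> dying Q V f J r"
  unfolding dying_def using f_in f_comp le2_trans by (smt (verit) mem_Collect_eq)

text \<open>Exactness lifts the pair formed by \<open>v\<close> and the zero element at an abscissa
  outside \<open>J1\<close>. The choice of that abscissa makes the lift die at every abscissa
  outside \<open>J1\<close>, even where their infimum is not attained.\<close>

lemma dying_lift_vertical: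
  assumes J: "J = J1 \<times> J2" "down_closed J1" "down_closed J2" "t \<notin> J1"
    and Q: "(x, y) \<in> Q" "y \<le> y'" and v: "v \<in> dying Q V f J (x, y')"
  obtains z where "z \<in> dying Q V f J (x, y)" "f (x, y) (x, y') z = v"
proof (cases "(x, y') \<in> J")
  case False
  have Q': "(x, y') \<in> Q" using up[OF Q(1)] Q(2) by simp
  then have "v = 0" using v False f_id[of "(x, y')" v] by (auto simp: dying_def)
  then show thesis using that[of 0] Q subspace_0[OF dying_subspace[OF Q(1)]] by simp
next
  case True
  then have xJ: "x \<in> J1" "y' \<in> J2" using J by auto
  have above: "x \<le> a" if "a \<notin> J1" for a
    using that xJ(1) J(2) unfolding down_closed_def by (meson linorder_le_cases)
  \<comment> \<open>The kernels towards abscissas outside \<open>J1\<close> form a chain in the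
    finite-dimensional \<open>V (x, y)\<close>; \<open>t0\<close> is taken where the smallest of
    them occurs.\<close>
  let ?C = "{ker (x, y) (a, y) |a. a \<notin> J1}"
  obtain C where C: "C \<in> ?C" "\<And>C'. C' \<in> ?C \<Longrightarrow> C' \<subseteq> C \<Longrightarrow> C' = C"
  proof (rule minimal_subspace[OF Q(1), of ?C])
    show "?C \<noteq> {}" using J(4) by blast
    fix C assume "C \<in> ?C"
    then obtain a where "C = ker (x, y) (a, y)" "x \<le> a" using above by blast
    then show "subspace C \<and> C \<subseteq> V (x, y)" using ker_subspace[OF Q(1)] by (simp add: ker_sub)
  qed (rule that)
  then obtain t0 where t0: "t0 \<notin> J1" "C = ker (x, y) (t0, y)" by blast
  have Q': "(x, y') \<in> Q" "(t0, y) \<in> Q" "(t0, y') \<in> Q"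
    using up[OF Q(1)] Q(2) above[OF t0(1)] by simp_all
  have "f (x, y') (t0, y') v = 0"
    using v Q' t0(1) above[OF t0(1)] J(1) by (auto simp: dying_def)
  then have eq: "f (x, y') (t0, y') v = f (t0, y) (t0, y') 0" using Q' Q(2) by simp
  have "v \<in> V (x, y')" using v by (simp add: dying_def)
  then obtain z where z: "z \<in> V (x, y)" "f (x, y) (x, y') z = v" "f (x, y) (t0, y) z = 0"
    by (rule exact_lift[OF Q(1) above[OF t0(1)] Q(2) _ zero_in[OF Q'(2)] eq])
  have zJ: "f (x, y) (a, y) z = 0" if a: "a \<notin> J1" for a
  proof -
    have "ker (x, y) (t0, y) \<subseteq> ker (x, y) (a, y)"
    proof (cases "t0 \<le> a")
      case True
      then show ?thesis using ker_mono[OF Q(1)] above[OF t0(1)] by simp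
    next
      case False
      then have "ker (x, y) (a, y) \<subseteq> C"
        unfolding t0(2) using ker_mono[OF Q(1)] above[OF a] by simp
      then show ?thesis using C(2) a t0(2) by blast
    qed
    then show ?thesis using z by (auto simp: ker_def)
  qed
  have "f (x, y) (a, b) z = 0" if ab: "(a, b) \<in> Q" "x \<le> a" "y \<le> b" "(a, b) \<notin> J" for a b
  proof (cases "a \<in> J1")
    case False
    then have "f (a, y) (a, b) (f (x, y) (a, y) z) = 0"
      using zJ[OF False] up[OF Q(1), of "(a, y)"] ab by simp
    then show ?thesis using f_comp[OF Q(1), of "(a, y)" "(a, b)" z] ab z by simp
  next
    case True
    \<comment> \<open>A height outside \<open>J2\<close> lies above \<open>y'\<close>, so the map to
      \<open>(a, b)\<close> factors through \<open>v\<close>.\<close>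
    then have "b \<notin> J2" using ab J(1) by simp
    then have "y' \<le> b" using xJ(2) J(3) unfolding down_closed_def by (meson linorder_le_cases)
    then have "f (x, y') (a, b) v = 0" using v ab by (auto simp: dying_def)
    then show ?thesis using f_comp[OF Q(1), of "(x, y')" "(a, b)" z] ab z Q(2) \<open>y' \<le> b\<close> by simp
  qed
  then have "z \<in> dying Q V f J (x, y)" using z by (auto simp: dying_def)
  then show thesis using that z by blast
qed

lemma dying_lift_horizontal:
  assumes J: "J = J1 \<times> J2" "down_closed J1" "down_closed J2" "u \<notin> J2"
    and Q: "(x, y) \<in> Q" "x \<le> x'" and v: "v \<in> dying Q V f J (x', y)"
  obtains z where "z \<in> dying Q V f J (x, y)" "f (x, y) (x', y) z = v"
proof -
  interpret sw: middle_exact_module s "prod.swap -` Q" "V \<circ> prod.swap" "swap_maps f"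
    by (rule swap_module)
  have "prod.swap -` J = J2 \<times> J1" using J(1) by auto
  from sw.dying_lift_vertical[OF this J(3,2,4), of y x x' v] show thesis
    using Q v that unfolding dying_swap by auto
qed

lemma dying_lift:
  assumes J: "J = J1 \<times> J2" "down_closed J1" "down_closed J2" "t \<notin> J1" "u \<notin> J2"
    and Q: "q \<in> Q" "le2 q r" and v: "v \<in> dying Q V f J r"
  obtains z where "z \<in> dying Q V f J q" "f q r z = v"
proof -
  obtain x y x' y' where qr: "q = (x, y)" "r = (x', y')" by (cases q, cases r)
  have le: "x \<le> x'" "y \<le> y'" using Q qr by auto
  have Q': "(x, y') \<in> Q" using up Q qr le by auto
  obtain w where w: "w \<in> dying Q V f J (x, y')" "f (x, y') (x', y') w = v"
    using dying_lift_horizontal[OF J(1,2,3,5) Q' le(1)] v qr by blast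
  obtain z where z: "z \<in> dying Q V f J (x, y)" "f (x, y) (x, y') z = w"
    using dying_lift_vertical[OF J(1-4) _ le(2) w(1)] Q qr by blast
  have "f q r z = v" using f_comp[of q "(x, y')" r z] Q qr le z w subsetD[OF dying_sub z(1)] by auto
  then show thesis using that z qr by blast
qed

context
  fixes J J1 J2 t u
  assumes J: "J = J1 \<times> J2" "down_closed J1" "down_closed J2" "t \<notin> J1" "u \<notin> J2"
begin

text \<open>Compatible elements on finitely many points of an antidiagonal are chosen one after the
  other, moving away from \<open>a\<close> in both directions.\<close>

lemma antidiagonal_family:
  assumes c: "\<And>x. (x, c - x) \<in> Q" and m: "m \<in> dying Q V f J (a, c - a)" and "finite X"
  obtains g where "g a = m" "\<And>x. x \<in> X \<Longrightarrow> g x \<in> dying Q V f J (x, c - x)"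
    "\<And>x y. x \<in> X \<Longrightarrow> y \<in> X \<Longrightarrow> x \<le> y \<Longrightarrow>
       f (x, c - x) (y, c - x) (g x) = f (y, c - y) (y, c - x) (g y)"
proof -
  define A where "A x = dying Q V f J (x, c - x)" for x
  have AV: "v \<in> V (x, c - x)" if "v \<in> A x" for x v using that dying_sub by (auto simp: A_def)
  \<comment> \<open>Compatibility of elements at two incomparable points of the antidiagonal is
    tested at their join \<open>(y, c - x)\<close>.\<close>
  define R where "R x y v w \<longleftrightarrow> f (x, c - x) (y, c - x) v = f (y, c - y) (y, c - x) w" for x y v w
  have R_refl: "R x x v v" for x v by (simp add: R_def)
  \<comment> \<open>Everything is carried to \<open>(z, c - x)\<close>, the join of the outer two
    points, which lies above both intermediate joins.\<close>
  have R_trans: "R x z v v''" if "x \<le> y" "y \<le> z" and v: "v \<in> A x" "v' \<in> A y" "v'' \<in> A z"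
    and R: "R x y v v'" "R y z v' v''" for x y z v v' v''
  proof -
    have "f (x, c - x) (z, c - x) v = f (y, c - x) (z, c - x) (f (x, c - x) (y, c - x) v)"
      using f_comp[OF c[of x], of "(y, c - x)" "(z, c - x)" v] AV v that by simp
    also have "\<dots> = f (y, c - x) (z, c - x) (f (y, c - y) (y, c - x) v')"
      using R by (simp add: R_def)
    also have "\<dots> = f (y, c - y) (z, c - x) v'"
      using f_comp[OF c[of y], of "(y, c - x)" "(z, c - x)" v'] AV v that by simp
    also have "\<dots> = f (z, c - y) (z, c - x) (f (y, c - y) (z, c - y) v')"
      using f_comp[OF c[of y], of "(z, c - y)" "(z, c - x)" v'] AV v that by simp
    also have "\<dots> = f (z, c - y) (z, c - x) (f (z, c - z) (z, c - y) v'')"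
      using R by (simp add: R_def)
    also have "\<dots> = f (z, c - z) (z, c - x) v''"
      using f_comp[OF c[of z], of "(z, c - y)" "(z, c - x)" v''] AV v that by simp
    finally show ?thesis by (simp add: R_def)
  qed
  \<comment> \<open>Up to the join and down again: the pushed element still dies outside
    \<open>J\<close>, so \<open>dying_lift\<close> brings it down to the other point.\<close>
  have R_right: "\<exists>w\<in>A y. R x y v w" if xy: "x \<le> y" and v: "v \<in> A x" for x y v
  proof -
    have "f (x, c - x) (y, c - x) v \<in> dying Q V f J (y, c - x)"
      using dying_f[OF c[of x]] v xy by (simp add: A_def)
    then obtain w where "w \<in> dying Q V f J (y, c - y)"
      "f (y, c - y) (y, c - x) w = f (x, c - x) (y, c - x) v"
      using dying_lift[OF J c[of y], of "(y, c - x)"] xy by auto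
    then show ?thesis by (intro bexI[of _ w]) (simp_all add: A_def R_def)
  qed
  have R_left: "\<exists>w\<in>A x. R x y w v" if xy: "x \<le> y" and v: "v \<in> A y" for x y v
  proof -
    have "f (y, c - y) (y, c - x) v \<in> dying Q V f J (y, c - x)"
      using dying_f[OF c[of y]] v xy by (simp add: A_def)
    then obtain w where "w \<in> dying Q V f J (x, c - x)"
      "f (x, c - x) (y, c - x) w = f (y, c - y) (y, c - x) v"
      using dying_lift[OF J c[of x], of "(y, c - x)"] xy by auto
    then show ?thesis by (intro bexI[of _ w]) (simp_all add: A_def R_def)
  qed
  have mA: "m \<in> A a" using m by (simp add: A_def)
  have "\<exists>g. g a = m \<and> (\<forall>x\<in>insert a {x \<in> X. a \<le> x}. g x \<in> A x) \<and>
    (\<forall>x\<in>insert a {x \<in> X. a \<le> x}. \<forall>y\<in>insert a {x \<in> X. a \<le> x}. x \<le> y \<longrightarrow> R x y (g x) (g y))"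
    using assms(3) by (intro finite_chain_choice mA R_right R_refl) (auto intro: R_trans)
  then obtain g where g: "g a = m" "\<And>x. x \<in> X \<Longrightarrow> a \<le> x \<Longrightarrow> g x \<in> A x"
    "\<And>x y. x \<in> insert a {x \<in> X. a \<le> x} \<Longrightarrow> y \<in> insert a {x \<in> X. a \<le> x} \<Longrightarrow> x \<le> y \<Longrightarrow> R x y (g x) (g y)"
    by blast
  \<comment> \<open>Negating the abscissas turns the walk to the left into one that increases, as
    \<open>finite_chain_choice\<close> requires.\<close>
  let ?X' = "uminus ` {x \<in> X. x \<le> a}"
  have "\<exists>g. g (- a) = m \<and> (\<forall>x\<in>insert (- a) ?X'. g x \<in> A (- x)) \<and>
    (\<forall>x\<in>insert (- a) ?X'. \<forall>y\<in>insert (- a) ?X'. x \<le> y \<longrightarrow> R (- y) (- x) (g y) (g x))"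
  proof (rule finite_chain_choice[of ?X' "- a" m "\<lambda>x. A (- x)" "\<lambda>x y v w. R (- y) (- x) w v"])
    show "\<exists>w\<in>A (- y). R (- y) (- x) w v" if "x \<le> y" "v \<in> A (- x)" for x y v
      using R_left[of "- y" "- x" v] that by simp
    show "R (- z) (- x) w v" if "x \<le> y" "y \<le> z" "v \<in> A (- x)" "v' \<in> A (- y)" "w \<in> A (- z)"
      "R (- y) (- x) v' v" "R (- z) (- y) w v'" for x y z v v' w
      using R_trans[of "- z" "- y" "- x" w v' v] that by simp
  qed (use assms(3) mA in \<open>auto simp: R_refl\<close>)
  then obtain h where h: "h (- a) = m" "\<And>x. x \<in> insert (- a) ?X' \<Longrightarrow> h x \<in> A (- x)"
    "\<And>x y. x \<in> insert (- a) ?X' \<Longrightarrow> y \<in> insert (- a) ?X' \<Longrightarrow> x \<le> y \<Longrightarrow> R (- y) (- x) (h y) (h x)"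
    by blast
  have h_A: "h (- x) \<in> A x" if "x \<in> X" "x \<le> a" for x
    using h(2)[of "- x"] that by simp
  have h_R: "R x y (h (- x)) (h (- y))" if "x \<in> insert a X" "y \<in> insert a X" "x \<le> y" "y \<le> a" for x y
    using h(3)[of "- y" "- x"] that by auto
  define k where "k x = (if a \<le> x then g x else h (- x))" for x
  have k_A: "k x \<in> A x" if "x \<in> X" for x using that g(2) h_A by (auto simp: k_def)
  have k_R: "R x y (k x) (k y)" if xy: "x \<in> X" "y \<in> X" "x \<le> y" for x y
  proof -
    consider "a \<le> x" | "y < a" | "x < a" "a \<le> y" by linarith
    then show ?thesis
    proof cases
      case 1
      then show ?thesis using g(3)[of x y] xy by (simp add: k_def)
    next
      case 2
      then show ?thesis using h_R[of x y] xy by (simp add: k_def)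
    next
      case 3
      \<comment> \<open>Points on different sides of \<open>a\<close> are compared through
        \<open>m\<close>, the value shared by both walks.\<close>
      have "R x a (k x) m" using h_R[of x a] 3 xy h(1) by (simp add: k_def)
      moreover have "R a y m (k y)" using g(3)[of a y] 3 xy g(1) by (simp add: k_def)
      ultimately show ?thesis
        using R_trans[of x a y "k x" m "k y"] 3 k_A xy mA by simp
    qed
  qed
  have "k a = m" using g(1) by (simp add: k_def)
  then show thesis using k_A k_R unfolding A_def R_def by (rule that)
qed

text \<open>Compactness leaves a finite set \<open>F\<close>. The element \<open>m\<close> is lifted
  straight down to an antidiagonal below \<open>F\<close>, completed there to a compatible family,
  and the value at each \<open>q\<close> is pushed up from the point of the antidiagonal beneath
  it.\<close>

lemma dying_coherent_exists:
  assumes p: "p \<in> Q" and m: "m \<in> dying Q V f J p"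
  obtains e where "coherent (dying Q V f J) Q e" "e p = m"
proof (rule coherent_exists[OF order_refl dying_subspace dying_sub p])
  fix F assume F: "finite F" "F \<subseteq> Q" "p \<in> F"
  obtain c where c: "\<And>x. (x, c - x) \<in> Q" "\<And>q. q \<in> F \<Longrightarrow> c \<le> fst q + snd q"
    using antidiagonal[OF F(1,2)] by blast
  define \<alpha> where "\<alpha> q = (fst q, c - fst q)" for q :: "real \<times> real"
  have \<alpha>: "\<alpha> q \<in> Q" "le2 (\<alpha> q) q" if "q \<in> F" for q
    using c(1) c(2)[OF that] by (auto simp: \<alpha>_def le2_def)
  obtain m0 where m0: "m0 \<in> dying Q V f J (\<alpha> p)" "f (\<alpha> p) p m0 = m"
    using dying_lift[OF J \<alpha>[OF F(3)] m] .
  obtain g where g: "g (fst p) = m0" "\<And>x. x \<in> fst ` F \<Longrightarrow> g x \<in> dying Q V f J (x, c - x)"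
    "\<And>x y. x \<in> fst ` F \<Longrightarrow> y \<in> fst ` F \<Longrightarrow> x \<le> y \<Longrightarrow>
       f (x, c - x) (y, c - x) (g x) = f (y, c - y) (y, c - x) (g y)"
    using antidiagonal_family[OF c(1) m0(1)[unfolded \<alpha>_def] finite_imageI[OF F(1)], of fst] by blast
  define e where "e q = f (\<alpha> q) q (g (fst q))" for q
  have gq: "g (fst q) \<in> dying Q V f J (\<alpha> q)" if "q \<in> F" for q
    using g(2) that by (simp add: \<alpha>_def)
  have "coherent (dying Q V f J) F e"
    unfolding coherent_def
  proof (intro conjI ballI impI)
    show "e q \<in> dying Q V f J q" if "q \<in> F" for q
      unfolding e_def by (rule dying_f[OF \<alpha>[OF that] gq[OF that]])
  next
    fix q r assume qr: "q \<in> F" "r \<in> F" "le2 q r"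
    \<comment> \<open>The join of the antidiagonal points beneath \<open>q\<close> and
      \<open>r\<close>; it lies below \<open>r\<close>, so agreement there gives agreement at
      \<open>r\<close>.\<close>
    let ?j = "(fst r, c - fst q)"
    have j: "le2 (\<alpha> q) ?j" "le2 (\<alpha> r) ?j" "le2 ?j r"
      using qr(3) c(2)[OF qr(1)] by (auto simp: \<alpha>_def le2_def)
    have gV: "g (fst q) \<in> V (\<alpha> q)" "g (fst r) \<in> V (\<alpha> r)"
      using gq qr dying_sub by blast+
    have "f q r (e q) = f (\<alpha> q) r (g (fst q))"
      unfolding e_def by (rule f_comp[OF \<alpha>[OF qr(1)] qr(3) gV(1)])
    also have "\<dots> = f ?j r (f (\<alpha> q) ?j (g (fst q)))"
      by (rule f_comp[OF \<alpha>(1)[OF qr(1)] j(1,3) gV(1), symmetric])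
    also have "\<dots> = f ?j r (f (\<alpha> r) ?j (g (fst r)))"
      using g(3)[of "fst q" "fst r"] qr by (simp add: \<alpha>_def le2_def)
    also have "\<dots> = e r"
      unfolding e_def by (rule f_comp[OF \<alpha>(1)[OF qr(2)] j(2,3) gV(2)])
    finally show "f q r (e q) = e r" .
  qed
  moreover have "e p = m" using m0(2) g(1) by (simp add: e_def)
  ultimately show "\<exists>e. coherent (dying Q V f J) F e \<and> e p = m" by blast
qed (assumption, rule that)

end

text \<open>An element that dies in both directions, chosen so that its horizontal and then its vertical
  lifetime are minimal, generates a death block summand.\<close>

lemma block_summand_if_doubly_dying:
  assumes p: "p \<in> Q" and v: "v \<in> V p" "v \<noteq> 0"
    and t: "fst p \<le> t" "f p (t, snd p) v = 0" and u: "snd p \<le> u" "f p (fst p, u) v = 0"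
  shows "\<exists>J e \<pi>. block_summand s Q V f J e \<pi>"
proof -
  define x y where "x = fst p" and "y = snd p"
  have pxy: "p = (x, y)" by (simp add: x_def y_def)
  \<comment> \<open>The maximum makes both kernel filtrations monotone over all reals; to the left
    of, respectively below, \<open>p\<close> they are zero.\<close>
  define H where "H a = ker p (max x a, y)" for a
  define U where "U b = ker p (x, max y b)" for b
  have H: "subspace (H a)" "H a \<subseteq> V p" for a
    unfolding H_def using ker_subspace[OF p] ker_sub by (auto simp: pxy)
  have U: "subspace (U b)" "U b \<subseteq> V p" for b
    unfolding U_def using ker_subspace[OF p] ker_sub by (auto simp: pxy)
  have H_mono: "H a \<subseteq> H b" if "a \<le> b" for a b
    unfolding H_def by (rule ker_mono[OF p]) (use that in \<open>auto simp: pxy\<close>)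
  have U_mono: "U a \<subseteq> U b" if "a \<le> b" for a b
    unfolding U_def by (rule ker_mono[OF p]) (use that in \<open>auto simp: pxy\<close>)
  have vHU: "v \<in> H t \<inter> U u" using v t u by (simp add: H_def U_def ker_def x_def y_def max_absorb2)
  obtain t0 where t0: "H t0 \<inter> U u \<noteq> {0}" "\<And>a. H a \<inter> U u \<noteq> {0} \<Longrightarrow> H t0 \<inter> U u \<subseteq> H a \<inter> U u"
  proof (rule least_nonzero[OF p, of "\<lambda>a. H a \<inter> U u" t])
    show "H a \<inter> U u \<subseteq> H b \<inter> U u \<or> H b \<inter> U u \<subseteq> H a \<inter> U u" for a b
      using H_mono[of a b] H_mono[of b a] linear[of a b] by blast
  qed (use H U vHU v in \<open>auto intro: subspace_inter\<close>)
  define D where "D b = H t0 \<inter> U u \<inter> U b" for b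
  obtain u0 where u0: "D u0 \<noteq> {0}" "\<And>b. D b \<noteq> {0} \<Longrightarrow> D u0 \<subseteq> D b"
  proof (rule least_nonzero[OF p, of D u])
    show "subspace (D b)" for b unfolding D_def by (intro subspace_inter H U)
    show "D b \<subseteq> V p" for b using H unfolding D_def by blast
    show "D a \<subseteq> D b \<or> D b \<subseteq> D a" for a b
      using U_mono[of a b] U_mono[of b a] linear[of a b] unfolding D_def by blast
    show "D u \<noteq> {0}" using t0(1) by (simp add: D_def)
  qed (rule that)
  have "subspace (D u0)" unfolding D_def by (intro subspace_inter H U)
  then obtain m where m: "m \<in> D u0" "m \<noteq> 0" using u0(1) subspace_0 by blast
  have mV: "m \<in> V p" and mU: "m \<in> U u" and mH: "m \<in> H t0" using m H unfolding D_def by blast+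
  \<comment> \<open>The block is read off from the generator: the abscissas and the heights at which
    \<open>m\<close> survives the horizontal and the vertical map.\<close>
  define J1 where "J1 = {a. m \<notin> H a}"
  define J2 where "J2 = {b. m \<notin> U b}"
  define J where "J = J1 \<times> J2"
  have tJ: "t0 \<notin> J1" "u \<notin> J2" using mH mU by (auto simp: J1_def J2_def)
  have down: "down_closed J1" "down_closed J2"
    using H_mono U_mono unfolding down_closed_def J1_def J2_def by blast+
  have "x \<in> J1" "y \<in> J2" using m p mV by (auto simp: J1_def J2_def H_def U_def ker_def pxy)
  then have pJ: "p \<in> J" by (simp add: J_def pxy)
  have block: "is_block J"
    unfolding J_def by (rule is_block_death) (use down \<open>x \<in> J1\<close> \<open>y \<in> J2\<close> in auto)
  \<comment> \<open>Minimality of \<open>H t0 \<inter> U u\<close>: a nonzero element of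
    \<open>U u\<close> killed at an abscissa where \<open>m\<close> survives would give a nonzero
    intersection that omits \<open>m\<close>.\<close>
  have H0: "w = 0" if "a \<in> J1" "w \<in> H a" "w \<in> U u" for a w
  proof (rule ccontr)
    assume "w \<noteq> 0"
    then have "H t0 \<inter> U u \<subseteq> H a \<inter> U u" using t0(2)[of a] that by blast
    then show False using that m unfolding D_def J1_def by blast
  qed
  \<comment> \<open>If \<open>m\<close> died at \<open>(a, b)\<close>, exactness would split it into
    \<open>z\<close> killed horizontally at \<open>a\<close> and \<open>m - z\<close> killed
    vertically at \<open>b\<close>. Then \<open>z\<close> also lies in \<open>U u\<close>, so it is
    zero, and \<open>m\<close> itself dies at height \<open>b\<close>.\<close>
  have alive: "f p q m \<noteq> 0" if q: "q \<in> J" "le2 p q" for q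
  proof
    assume 0: "f p q m = 0"
    obtain a b where ab: "q = (a, b)" by (cases q)
    have le: "x \<le> a" "y \<le> b" using q ab pxy by auto
    have qJ: "a \<in> J1" "b \<in> J2" using q ab by (auto simp: J_def)
    have Q': "(x, b) \<in> Q" "(a, y) \<in> Q" using up[OF p] le pxy by auto
    have pQ: "(x, y) \<in> Q" using p pxy by simp
    have mV': "f p (x, b) m \<in> V (x, b)" using f_in[OF p _ mV] le pxy by simp
    have "f (x, b) (a, b) (f p (x, b) m) = 0"
      using f_comp[OF p, of "(x, b)" "(a, b)" m] mV le pxy 0 ab by simp
    then have "f (x, b) (a, b) (f p (x, b) m) = f (a, y) (a, b) 0" using Q' le by simp
    then obtain z where z: "z \<in> V (x, y)" "f (x, y) (x, b) z = f p (x, b) m" "f (x, y) (a, y) z = 0"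
      using exact_lift[OF pQ le mV' zero_in[OF Q'(2)]] by blast
    have zH: "z \<in> H a" using z le by (simp add: H_def ker_def pxy max_absorb2)
    have mz: "m - z \<in> U b"
      using z le mV f_diff[OF p, of "(x, b)" m z] p
      by (simp add: U_def ker_def pxy max_absorb2 diff_in)
    have "m - z \<in> U u"
      using mz U_mono[of b u] qJ tJ down(2) mU
      unfolding down_closed_def by (meson linorder_le_cases subsetD)
    then have "m - (m - z) \<in> U u" using subspace_diff[OF U(1) mU] by blast
    then have "z = 0" using H0[OF qJ(1) zH] by simp
    then show False using mz qJ(2) by (simp add: J2_def)
  qed
  have dead_r: "f p q m = 0" if q: "q \<notin> J" "le2 p q" for q
  proof -
    obtain a b where ab: "q = (a, b)" by (cases q)
    have le: "x \<le> a" "y \<le> b" using q ab pxy by auto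
    from q(1) have "m \<in> H a \<or> m \<in> U b" by (auto simp: J_def J1_def J2_def ab)
    then have "m \<in> ker p q"
    proof
      assume "m \<in> H a"
      then show ?thesis
        unfolding H_def using ker_mono[OF p, of "(max x a, y)" q] le ab pxy by (auto simp: max_absorb2)
    next
      assume "m \<in> U b"
      then show ?thesis
        unfolding U_def using ker_mono[OF p, of "(x, max y b)" q] le ab pxy by (auto simp: max_absorb2)
    qed
    then show ?thesis by (simp add: ker_def)
  qed
  have mS: "m \<in> dying Q V f J p" using mV dead_r by (simp add: dying_def)
  obtain e where e: "coherent (dying Q V f J) Q e" "e p = m"
    by (rule dying_coherent_exists[OF J_def down tJ p mS])
  have eS: "e q \<in> dying Q V f J q" if "q \<in> Q" for q using e that by (simp add: coherent_def)
  have ef: "f q r (e q) = e r" if "q \<in> Q" "r \<in> Q" "le2 q r" for q r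
    using e that by (simp add: coherent_def)
  have "\<exists>e' \<pi>. block_summand s Q V f J e' \<pi>"
  proof (rule block_summandI[of J p e "\<lambda>_. {0}"])
    show "is_block J" by (rule block)
    show "p \<in> J \<inter> Q" using pJ p by simp
    show "join q r \<in> J" if "q \<in> J \<inter> Q" "r \<in> J \<inter> Q" for q r
      using that by (auto simp: J_def join_def max_def)
    show "e q \<in> V q" if "q \<in> J \<inter> Q" for q using eS[of q] that dying_sub by blast
    show "f q r (e q) = (if r \<in> J then e r else 0)" if "q \<in> J \<inter> Q" "r \<in> Q" "le2 q r" for q r
      using that ef[of q r] eS[of q] by (auto simp: dying_def)
    \<comment> \<open>Vacuous: \<open>J\<close> is downward closed, so nothing enters it from
      outside and the zero subspace serves as \<open>L\<close>.\<close>
    show "f q r w \<in> {0}" if "q \<in> Q - J" "r \<in> J" "le2 q r" for q r w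
      using that down by (auto simp: J_def le2_def down_closed_def mem_Times_iff)
    show "f q r w \<in> {0}" if "q \<in> J \<inter> Q" "le2 q r" "w \<in> {0}" for q r w
      using that by simp
    show "{0} \<subseteq> V r" if "r \<in> J \<inter> Q" for r using that by simp
    \<comment> \<open>The point \<open>r\<close> need not lie above \<open>p\<close>, so
      non-vanishing is tested at their join, which is again in \<open>J\<close>.\<close>
    show "e r \<notin> {0}" if r: "r \<in> J \<inter> Q" for r
    proof
      let ?j = "join p r"
      assume "e r \<in> {0}"
      then have "e ?j = 0" using ef[of r ?j] r up[of r ?j] by simp
      then have "f p ?j m = 0" using ef[of p ?j] e(2) p up[of p ?j] by simp
      moreover have "?j \<in> J" using r pJ by (auto simp: J_def join_def max_def)
      ultimately show False using alive[of ?j] by simp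
    qed
  qed simp
  then show ?thesis by blast
qed

section \<open>Bands\<close>

lemma column_nonempty: obtains Y where "b \<le> Y" "(a, Y) \<in> Q"
proof -
  obtain c where "\<forall>x. (x, c - x) \<in> Q" using antidiagonal[of "{}"] by auto
  then have "(a, max b (c - a)) \<in> Q" using up[of "(a, c - a)"] by simp
  then show thesis using that[of "max b (c - a)"] by simp
qed

text \<open>The elements at \<open>p\<close> that come from abscissa \<open>a\<close>, possibly only after moving upwards: the
  column over \<open>a\<close> need not reach \<open>Q\<close> at the height of \<open>p\<close>.\<close>

definition left_im :: "real \<times> real \<Rightarrow> real \<Rightarrow> 'v set" where
  "left_im p a = {v \<in> V p. \<exists>Y\<ge>snd p. (a, Y) \<in> Q \<and>
     (\<exists>w\<in>V (a, Y). f p (max (fst p) a, Y) v = f (a, Y) (max (fst p) a, Y) w)}"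

lemma left_im_sub: "left_im p a \<subseteq> V p"
  by (auto simp: left_im_def)

text \<open>A witness can be pushed further up its column, so several membership conditions can be
  tested at one common height.\<close>

lemma left_im_raise:
  assumes p: "p \<in> Q" and v: "v \<in> left_im p a"
  obtains Y0 where "snd p \<le> Y0" "\<And>Y. Y0 \<le> Y \<Longrightarrow> (a, Y) \<in> Q \<and>
    (\<exists>w\<in>V (a, Y). f p (max (fst p) a, Y) v = f (a, Y) (max (fst p) a, Y) w)"
proof -
  let ?x = "max (fst p) a"
  obtain Y0 w where Y0: "snd p \<le> Y0" "(a, Y0) \<in> Q" "w \<in> V (a, Y0)"
    "f p (?x, Y0) v = f (a, Y0) (?x, Y0) w" "v \<in> V p"
    using v by (auto simp: left_im_def)
  have "(a, Y) \<in> Q \<and> (\<exists>w\<in>V (a, Y). f p (?x, Y) v = f (a, Y) (?x, Y) w)" if Y: "Y0 \<le> Y" for Y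
  proof (intro conjI bexI[of _ "f (a, Y0) (a, Y) w"])
    show "(a, Y) \<in> Q" using up[OF Y0(2)] Y by simp
    have "f p (?x, Y) v = f (?x, Y0) (?x, Y) (f p (?x, Y0) v)"
      using f_comp[OF p, of "(?x, Y0)" "(?x, Y)" v] Y Y0(1,5) by (simp add: le2_def)
    also have "\<dots> = f (a, Y0) (?x, Y) w"
      unfolding Y0(4) by (rule f_comp[OF Y0(2) _ _ Y0(3)]) (use Y in auto)
    also have "\<dots> = f (a, Y) (?x, Y) (f (a, Y0) (a, Y) w)"
      by (rule f_comp[OF Y0(2) _ _ Y0(3), symmetric]) (use Y in auto)
    finally show "f p (?x, Y) v = f (a, Y) (?x, Y) (f (a, Y0) (a, Y) w)" .
    show "f (a, Y0) (a, Y) w \<in> V (a, Y)"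
      by (rule f_in[OF Y0(2) _ Y0(3)]) (use Y in simp)
  qed
  then show thesis using that Y0(1) by blast
qed

lemma left_im_subspace:
  assumes p: "p \<in> Q"
  shows "subspace (left_im p a)"
proof (rule subspaceI)
  have le: "le2 p (max (fst p) a, Y)" if "snd p \<le> Y" for Y using that by (simp add: le2_def)
  obtain Y where "snd p \<le> Y" "(a, Y) \<in> Q" by (rule column_nonempty)
  then show "0 \<in> left_im p a"
    using p le by (auto simp: left_im_def intro!: exI[of _ Y] bexI[of _ 0])
  fix v v' assume v: "v \<in> left_im p a" "v' \<in> left_im p a"
  obtain Y1 where Y1: "snd p \<le> Y1" "\<And>Y. Y1 \<le> Y \<Longrightarrow> (a, Y) \<in> Q \<and>
    (\<exists>w\<in>V (a, Y). f p (max (fst p) a, Y) v = f (a, Y) (max (fst p) a, Y) w)"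
    using left_im_raise[OF p v(1)] by blast
  obtain Y2 where Y2: "snd p \<le> Y2" "\<And>Y. Y2 \<le> Y \<Longrightarrow> (a, Y) \<in> Q \<and>
    (\<exists>w\<in>V (a, Y). f p (max (fst p) a, Y) v' = f (a, Y) (max (fst p) a, Y) w)"
    using left_im_raise[OF p v(2)] by blast
  define Y where "Y = max Y1 Y2"
  have Y: "Y1 \<le> Y" "Y2 \<le> Y" "snd p \<le> Y" using Y1 Y2 by (auto simp: Y_def)
  obtain w w' where w: "(a, Y) \<in> Q" "w \<in> V (a, Y)" "w' \<in> V (a, Y)"
    "f p (max (fst p) a, Y) v = f (a, Y) (max (fst p) a, Y) w"
    "f p (max (fst p) a, Y) v' = f (a, Y) (max (fst p) a, Y) w'"
    using Y1(2)[OF Y(1)] Y2(2)[OF Y(2)] by blast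
  have vV: "v \<in> V p" "v' \<in> V p" using v left_im_sub by blast+
  have "f p (max (fst p) a, Y) (v + v') = f (a, Y) (max (fst p) a, Y) (w + w')"
    using w vV p le[OF Y(3)] by (simp add: f_add)
  then show "v + v' \<in> left_im p a"
    unfolding left_im_def using w Y(3) vV add_in p by blast
next
  fix b v assume "v \<in> left_im p a"
  then obtain Y w where w: "v \<in> V p" "snd p \<le> Y" "(a, Y) \<in> Q" "w \<in> V (a, Y)"
    "f p (max (fst p) a, Y) v = f (a, Y) (max (fst p) a, Y) w"
    by (auto simp: left_im_def)
  have "f p (max (fst p) a, Y) (s b v) = f (a, Y) (max (fst p) a, Y) (s b w)"
    using w p by (simp add: f_scale le2_def)
  then show "s b v \<in> left_im p a"
    unfolding left_im_def using w scale_in p by blast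
qed

lemma left_im_mono:
  assumes p: "p \<in> Q" and "a \<le> b"
  shows "left_im p a \<subseteq> left_im p b"
proof
  fix v assume "v \<in> left_im p a"
  then obtain Y w where w: "v \<in> V p" "snd p \<le> Y" "(a, Y) \<in> Q" "w \<in> V (a, Y)"
    "f p (max (fst p) a, Y) v = f (a, Y) (max (fst p) a, Y) w"
    by (auto simp: left_im_def)
  let ?xa = "max (fst p) a" and ?xb = "max (fst p) b"
  have "f p (?xb, Y) v = f (?xa, Y) (?xb, Y) (f p (?xa, Y) v)"
    by (rule f_comp[OF p _ _ w(1), symmetric]) (use w assms in \<open>auto simp: le2_def\<close>)
  also have "\<dots> = f (a, Y) (?xb, Y) w"
    unfolding w(5) by (rule f_comp[OF w(3) _ _ w(4)]) (use assms in auto)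
  also have "\<dots> = f (b, Y) (?xb, Y) (f (a, Y) (b, Y) w)"
    by (rule f_comp[OF w(3) _ _ w(4), symmetric]) (use assms in auto)
  finally have "f p (?xb, Y) v = f (b, Y) (?xb, Y) (f (a, Y) (b, Y) w)" .
  moreover have "f (a, Y) (b, Y) w \<in> V (b, Y)" "(b, Y) \<in> Q"
    using f_in[OF w(3) _ w(4), of "(b, Y)"] up[OF w(3), of "(b, Y)"] assms by auto
  ultimately show "v \<in> left_im p b"
    unfolding left_im_def using w by blast
qed

lemma left_im_ge:
  assumes p: "p \<in> Q" and "fst p \<le> a"
  shows "left_im p a = V p"
proof -
  have "v \<in> left_im p (fst p)" if "v \<in> V p" for v
    unfolding left_im_def using that p by (auto intro!: exI[of _ "snd p"])
  then show ?thesis using left_im_mono[OF p assms(2)] left_im_sub by blast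
qed

text \<open>For a convex \<open>I\<close> containing \<open>fst r\<close> these are the elements
  arriving from the left of \<open>I\<close>, an increasing union of images. Looking only at the row
  of \<open>r\<close> suffices, since an element from a lower row can first be moved up its column.
  Zero is added because the row may contain no suitable point of \<open>Q\<close>.\<close>

definition lower :: "real set \<Rightarrow> real \<times> real \<Rightarrow> 'v set" where
  "lower I r = {v \<in> V r. v = 0 \<or> (\<exists>a\<le>fst r. a \<notin> I \<and> (a, snd r) \<in> Q \<and> (\<exists>w\<in>V (a, snd r). v = f (a, snd r) r w))}"

lemma lower_sub: "lower I r \<subseteq> V r"
  by (auto simp: lower_def)

lemma lower_out:
  assumes "q \<in> Q" "fst q \<notin> I" "le2 q r" "v \<in> V q"
  shows "f q r v \<in> lower I r"
proof -
  let ?q = "(fst q, snd r)"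
  have le: "le2 q ?q" "le2 ?q r" using assms(3) by (auto simp: le2_def)
  have "f q r v = f ?q r (f q ?q v)" by (rule f_comp[OF assms(1) le assms(4), symmetric])
  moreover have "f q ?q v \<in> V ?q" "?q \<in> Q" using f_in up le assms by blast+
  moreover have "fst q \<le> fst r" "f q r v \<in> V r" using assms f_in by (auto simp: le2_def)
  ultimately show ?thesis unfolding lower_def using assms(2) by blast
qed

lemma lower_subspace:
  assumes r: "r \<in> Q"
  shows "subspace (lower I r)"
proof (rule subspaceI)
  show "0 \<in> lower I r" using r by (simp add: lower_def)
  fix v v' assume v: "v \<in> lower I r" "v' \<in> lower I r"
  show "v + v' \<in> lower I r"
  proof (cases "v = 0 \<or> v' = 0")
    case True
    then show ?thesis using v by auto
  next
    case False
    obtain a w a' w' where w: "a \<le> fst r" "a \<notin> I" "(a, snd r) \<in> Q" "w \<in> V (a, snd r)" "v = f (a, snd r) r w"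
      "a' \<le> fst r" "a' \<notin> I" "(a', snd r) \<in> Q" "w' \<in> V (a', snd r)" "v' = f (a', snd r) r w'"
      using v False by (auto simp: lower_def)
    let ?a = "max a a'"
    let ?q = "(?a, snd r)"
    have le: "le2 (a, snd r) ?q" "le2 (a', snd r) ?q" "le2 ?q r" using w by (auto simp: le2_def)
    have q: "?q \<in> Q" using up[OF w(3) le(1)] .
    have V: "f (a, snd r) ?q w \<in> V ?q" "f (a', snd r) ?q w' \<in> V ?q"
      using f_in le w by blast+
    have "v + v' = f ?q r (f (a, snd r) ?q w + f (a', snd r) ?q w')"
      unfolding f_add[OF q le(3) V] f_comp[OF w(3) le(1,3) w(4)] f_comp[OF w(8) le(2,3) w(9)] w(5,10) ..
    also have "\<dots> \<in> lower I r"
      by (rule lower_out[OF q _ le(3) add_in[OF q V]]) (use w in \<open>simp add: max_def\<close>)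
    finally show ?thesis .
  qed
next
  fix b v assume "v \<in> lower I r"
  then consider "v = 0" | a w where "a \<le> fst r" "a \<notin> I" "(a, snd r) \<in> Q" "w \<in> V (a, snd r)" "v = f (a, snd r) r w"
    by (auto simp: lower_def)
  then show "s b v \<in> lower I r"
  proof cases
    case 1
    then show ?thesis using r by (simp add: lower_def)
  next
    case 2
    have le: "le2 (a, snd r) r" using 2 by (simp add: le2_def)
    have "s b v = f (a, snd r) r (s b w)" using f_scale[OF 2(3) le 2(4)] 2(5) by simp
    then show ?thesis using lower_out[OF 2(3) _ le scale_in[OF 2(3,4)]] 2(2) by simp
  qed
qed

lemma lower_f:
  assumes "q \<in> Q" "le2 q r" "v \<in> lower I q"
  shows "f q r v \<in> lower I r"
proof -
  have "r \<in> Q" using up assms by blast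
  consider "v = 0" | a w where "a \<le> fst q" "a \<notin> I" "(a, snd q) \<in> Q" "w \<in> V (a, snd q)" "v = f (a, snd q) q w"
    using assms(3) by (auto simp: lower_def)
  then show ?thesis
  proof cases
    case 1
    then show ?thesis using subspace_0[OF lower_subspace[OF \<open>r \<in> Q\<close>]] assms by simp
  next
    case 2
    have le: "le2 (a, snd q) q" using 2 by (simp add: le2_def)
    have "f q r v = f (a, snd q) r w" unfolding 2(5) by (rule f_comp[OF 2(3) le assms(2) 2(4)])
    then show ?thesis using lower_out[OF 2(3) _ le2_trans[OF le assms(2)] 2(4)] 2(2) by simp
  qed
qed

definition hdying :: "real \<times> real \<Rightarrow> 'v set" where
  "hdying q = {w \<in> V q. \<exists>a\<ge>fst q. f q (a, snd q) w = 0}"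

lemma hdying_sub: "hdying q \<subseteq> V q"
  by (auto simp: hdying_def)

lemma hdying_f:
  assumes "q \<in> Q" "le2 q r" "w \<in> hdying q"
  shows "f q r w \<in> hdying r"
proof -
  obtain a where a: "fst q \<le> a" "f q (a, snd q) w = 0" and w: "w \<in> V q"
    using assms by (auto simp: hdying_def)
  let ?a = "max a (fst r)"
  have le: "le2 q (a, snd q)" "le2 (a, snd q) (?a, snd r)" "le2 r (?a, snd r)"
    using a(1) assms(2) by (auto simp: le2_def)
  have "f r (?a, snd r) (f q r w) = f q (?a, snd r) w"
    by (rule f_comp[OF assms(1,2) le(3) w])
  also have "\<dots> = f (a, snd q) (?a, snd r) (f q (a, snd q) w)"
    by (rule f_comp[OF assms(1) le(1,2) w, symmetric])
  also have "\<dots> = 0" unfolding a(2) by (rule f_zero[OF up[OF assms(1) le(1)] le(2)])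
  finally show ?thesis
    unfolding hdying_def using f_in[OF assms(1,2) w] by (auto intro!: exI[of _ ?a])
qed

lemma hdying_subspace:
  assumes q: "q \<in> Q"
  shows "subspace (hdying q)"
proof (rule subspaceI)
  show "0 \<in> hdying q" using q by (auto simp: hdying_def le2_def intro!: exI[of _ "fst q"])
  fix v w assume "v \<in> hdying q" "w \<in> hdying q"
  then obtain a b where v: "v \<in> V q" "fst q \<le> a" "f q (a, snd q) v = 0"
    and w: "w \<in> V q" "fst q \<le> b" "f q (b, snd q) w = 0" by (auto simp: hdying_def)
  let ?c = "(max a b, snd q)"
  have "v \<in> ker q ?c" using ker_mono[OF q, of "(a, snd q)" ?c] v by (auto simp: ker_def le2_def)
  moreover have "w \<in> ker q ?c" using ker_mono[OF q, of "(b, snd q)" ?c] w by (auto simp: ker_def le2_def)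
  moreover have "le2 q ?c" using v by (simp add: le2_def max_def)
  ultimately have "v + w \<in> ker q ?c" using subspace_add[OF ker_subspace[OF q]] by blast
  then show "v + w \<in> hdying q"
    using v(2) by (auto simp: ker_def hdying_def intro!: exI[of _ "max a b"])
next
  fix c v assume "v \<in> hdying q"
  then show "s c v \<in> hdying q" using q by (auto simp: hdying_def scale_in f_scale le2_def)
qed

lemma hdying_pull:
  assumes "(x, y) \<in> Q" "x \<le> x'" "w \<in> V (x, y)" "f (x, y) (x', y) w \<in> hdying (x', y)"
  shows "w \<in> hdying (x, y)"
proof -
  obtain a where a: "x' \<le> a" "f (x', y) (a, y) (f (x, y) (x', y) w) = 0"
    using assms(4) by (auto simp: hdying_def)
  then have "f (x, y) (a, y) w = 0" using f_comp[OF assms(1), of "(x', y)" "(a, y)" w] assms by simp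
  then show ?thesis using assms a by (auto simp: hdying_def intro!: exI[of _ a])
qed

text \<open>Exactness applied to \<open>w\<close> and the zero element at \<open>(a, y)\<close>,
  where \<open>a\<close> is an abscissa at which \<open>w\<close> is dead; the lift dies there as
  well.\<close>

lemma hdying_vertical_surj:
  assumes "(x, y) \<in> Q" "y \<le> y'" "w \<in> hdying (x, y')"
  obtains z where "z \<in> hdying (x, y)" "f (x, y) (x, y') z = w"
proof -
  obtain a where a: "x \<le> a" "f (x, y') (a, y') w = 0" and w: "w \<in> V (x, y')"
    using assms(3) by (auto simp: hdying_def)
  have aQ: "(a, y) \<in> Q" using up[OF assms(1)] a(1) by simp
  have eq: "f (x, y') (a, y') w = f (a, y) (a, y') 0" using a aQ assms(2) by simp
  obtain z where z: "z \<in> V (x, y)" "f (x, y) (x, y') z = w" "f (x, y) (a, y) z = 0"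
    by (rule exact_lift[OF assms(1) a(1) assms(2) w zero_in[OF aQ] eq])
  then have "z \<in> hdying (x, y)" using a(1) by (auto simp: hdying_def intro!: exI[of _ a])
  then show thesis using that z by blast
qed

text \<open>If nothing dies in both directions, the vertical maps restrict to isomorphisms between the
  spaces of horizontally dying elements, so these form a one-parameter module.\<close>

lemma block_summand_if_horizontally_dying:
  assumes inj: "\<And>q w b. q \<in> Q \<Longrightarrow> w \<in> hdying q \<Longrightarrow> snd q \<le> b \<Longrightarrow> f q (fst q, b) w = 0 \<Longrightarrow> w = 0"
    and p: "p \<in> Q" and v: "v \<in> hdying p" "v \<noteq> 0"
  shows "\<exists>J e \<pi>. block_summand s Q V f J e \<pi>"
proof -
  define x y where "x = fst p" and "y = snd p"
  have pxy: "p = (x, y)" by (simp add: x_def y_def)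
  have pQ: "(x, y) \<in> Q" using p pxy by simp
  define H where "H a = ker p (max x a, y)" for a
  have H: "subspace (H a)" "H a \<subseteq> V p" for a
    unfolding H_def using ker_subspace[OF p] ker_sub by (auto simp: pxy)
  have H_mono: "H a \<subseteq> H b" if "a \<le> b" for a b
    unfolding H_def by (rule ker_mono[OF p]) (use that in \<open>auto simp: pxy\<close>)
  have H_hd: "H a \<subseteq> hdying p" for a
    by (auto simp: H_def ker_def hdying_def pxy intro!: exI[of _ "max x a"])
  obtain t where t: "x \<le> t" "f p (t, y) v = 0" "v \<in> V p" using v(1) by (auto simp: hdying_def x_def y_def)
  then have "v \<in> H t" by (simp add: H_def ker_def max_absorb2)
  then have Ht: "H t \<noteq> {0}" using v(2) by blast
  obtain t0 where t0: "H t0 \<noteq> {0}" "\<And>a. H a \<noteq> {0} \<Longrightarrow> H t0 \<subseteq> H a"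
  proof (rule least_nonzero[OF p, of H t])
    show "H a \<subseteq> H b \<or> H b \<subseteq> H a" for a b
      using H_mono[of a b] H_mono[of b a] linear[of a b] by blast
  qed (use H Ht in auto)
  obtain m where m: "m \<in> H t0" "m \<noteq> 0" using t0(1) subspace_0[OF H(1)] by blast
  have mV: "m \<in> V p" and mhd: "m \<in> hdying p" using m H H_hd by blast+
  \<comment> \<open>The lifetime of \<open>m\<close> in the horizontal direction: it already comes
    from abscissa \<open>a\<close> and is not yet dead there.\<close>
  define I where "I = {a. m \<in> left_im p a \<and> m \<notin> H a}"
  define J where "J = I \<times> (UNIV :: real set)"
  \<comment> \<open>As \<open>m\<close> lies in the least nonzero kernel, no nonzero element at
    \<open>p\<close> dies at an abscissa where \<open>m\<close> survives.\<close>
  have H0: "H a = {0}" if "a \<in> I" for a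
    using that t0(2)[of a] m by (auto simp: I_def)
  have H_le: "H a = {0}" if "a \<le> x" for a
    using that p mV by (auto simp: H_def ker_def pxy max_absorb1)
  have xI: "x \<in> I" using left_im_ge[OF p, of x] mV m H_le[of x] by (simp add: I_def x_def)
  have convex: "c \<in> I" if "a \<in> I" "b \<in> I" "a \<le> c" "c \<le> b" for a b c
    using that left_im_mono[OF p, of a c] H_mono[of c b] by (auto simp: I_def)
  have pJ: "p \<in> J \<inter> Q" using xI p pxy by (simp add: J_def)
  have block: "is_block J"
    unfolding J_def
  proof (rule is_block_vertical)
    show "ord_convex I"
      unfolding ord_convex_def by (intro ballI allI impI, elim conjE) (rule convex)
  qed (use xI in blast)
  have join_J: "join q r \<in> J \<inter> Q" if "q \<in> J \<inter> Q" "r \<in> J \<inter> Q" for q r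
    using that up[of q "join q r"] by (auto simp: J_def join_def max_def mem_Times_iff le2_def)
  have hd_V: "\<And>q w. w \<in> hdying q \<Longrightarrow> w \<in> V q" using hdying_sub by blast
  \<comment> \<open>\<open>I\<close> need not have a least abscissa from which all values could be
    pushed, so the family is built over finite sets and completed by compactness.\<close>
  obtain e where e: "coherent hdying (J \<inter> Q) e" "e p = m"
  proof (rule coherent_exists[of "J \<inter> Q" hdying p m])
    show "subspace (hdying q)" if "q \<in> J \<inter> Q" for q using that hdying_subspace by simp
    fix F assume F: "finite F" "F \<subseteq> J \<inter> Q" "p \<in> F"
    define a where "a = Min (fst ` F)"
    have a: "a \<in> fst ` F" "\<And>q. q \<in> F \<Longrightarrow> a \<le> fst q"
      unfolding a_def using F by (auto intro!: Min_in)
    then have "a \<in> I" using F by (auto simp: J_def)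
    then have "m \<in> left_im p a" by (simp add: I_def)
    have ax: "a \<le> x" using a(2)[OF F(3)] by (simp add: x_def)
    obtain Y0 where Y0: "\<And>Y. Y0 \<le> Y \<Longrightarrow> (a, Y) \<in> Q \<and>
        (\<exists>w\<in>V (a, Y). f p (max (fst p) a, Y) m = f (a, Y) (max (fst p) a, Y) w)"
      using left_im_raise[OF p \<open>m \<in> left_im p a\<close>] by blast
    \<comment> \<open>High enough both for \<open>m\<close> to have a preimage over the leftmost
      abscissa \<open>a\<close> and to lie above every point of \<open>F\<close>.\<close>
    define Y where "Y = Max (insert Y0 (snd ` F))"
    have Y: "Y0 \<le> Y" "\<And>q. q \<in> F \<Longrightarrow> snd q \<le> Y" unfolding Y_def using F(1) by auto
    obtain w where aY: "(a, Y) \<in> Q" and w: "w \<in> V (a, Y)" "f p (x, Y) m = f (a, Y) (x, Y) w"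
      using Y0[OF Y(1)] ax by (auto simp: x_def max_absorb1)
    have "f p (x, Y) m \<in> hdying (x, Y)"
      by (rule hdying_f[OF p _ mhd]) (use Y(2)[OF F(3)] pxy in simp)
    then have wh: "w \<in> hdying (a, Y)" using hdying_pull[OF aY ax w(1)] w(2) by simp
    \<comment> \<open>The preimage \<open>w\<close> is moved right along height \<open>Y\<close> to
      the column of \<open>q\<close> and then lifted down that column; \<open>inj\<close> makes the
      lift unique, which yields coherence.\<close>
    have "\<exists>z\<in>hdying q. f q (fst q, Y) z = f (a, Y) (fst q, Y) w" if q: "q \<in> F" for q
    proof -
      have qQ: "(fst q, snd q) \<in> Q" using q F by auto
      have "f (a, Y) (fst q, Y) w \<in> hdying (fst q, Y)"
        by (rule hdying_f[OF aY _ wh]) (use a(2)[OF q] in simp)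
      then obtain z where "z \<in> hdying (fst q, snd q)" "f (fst q, snd q) (fst q, Y) z = f (a, Y) (fst q, Y) w"
        by (rule hdying_vertical_surj[OF qQ Y(2)[OF q]])
      then show ?thesis by auto
    qed
    then obtain d where d: "\<And>q. q \<in> F \<Longrightarrow> d q \<in> hdying q"
      "\<And>q. q \<in> F \<Longrightarrow> f q (fst q, Y) (d q) = f (a, Y) (fst q, Y) w" by metis
    have uniq: "z = z'" if q: "q \<in> F" and z: "z \<in> hdying q" "z' \<in> hdying q"
      "f q (fst q, Y) z = f q (fst q, Y) z'" for q z z'
    proof -
      have qQ: "q \<in> Q" using q F by auto
      have "f q (fst q, Y) (z - z') = 0"
        using f_diff[OF qQ, of "(fst q, Y)" z z'] hd_V z Y(2)[OF q] by (simp add: le2_def)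
      then have "z - z' = 0"
        using inj[OF qQ _ Y(2)[OF q]] subspace_diff[OF hdying_subspace[OF qQ]] z by blast
      then show ?thesis by simp
    qed
    have "coherent hdying F d"
      unfolding coherent_def
    proof (intro conjI ballI impI)
      fix q r assume qr: "q \<in> F" "r \<in> F" "le2 q r"
      have qQ: "q \<in> Q" using qr F by auto
      have le: "le2 q (fst q, Y)" "le2 (fst q, Y) (fst r, Y)" "le2 r (fst r, Y)" "le2 (a, Y) (fst q, Y)"
        using qr Y(2) a(2) by (auto simp: le2_def)
      have "f r (fst r, Y) (f q r (d q)) = f q (fst r, Y) (d q)"
        by (rule f_comp[OF qQ qr(3) le(3) hd_V[OF d(1)[OF qr(1)]]])
      also have "\<dots> = f (fst q, Y) (fst r, Y) (f q (fst q, Y) (d q))"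
        by (rule f_comp[OF qQ le(1,2) hd_V[OF d(1)[OF qr(1)]], symmetric])
      also have "\<dots> = f (a, Y) (fst r, Y) w"
        unfolding d(2)[OF qr(1)] by (rule f_comp[OF aY le(4,2) w(1)])
      also have "\<dots> = f r (fst r, Y) (d r)" by (rule d(2)[OF qr(2), symmetric])
      finally show "f q r (d q) = d r"
        by (rule uniq[OF qr(2) hdying_f[OF qQ qr(3) d(1)[OF qr(1)]] d(1)[OF qr(2)]])
    qed (rule d(1))
    moreover have "d p = m"
      by (rule uniq[OF F(3) d(1)[OF F(3)] mhd]) (use d(2)[OF F(3)] w(2) pxy in simp)
    ultimately show "\<exists>e. coherent hdying F e \<and> e p = m" by blast
  qed (use pJ hdying_sub in auto)
  have eh: "e q \<in> hdying q" if "q \<in> J \<inter> Q" for q using e that by (simp add: coherent_def)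
  have ef: "f q r (e q) = e r" if "q \<in> J \<inter> Q" "r \<in> J \<inter> Q" "le2 q r" for q r
    using e that by (simp add: coherent_def)
  have e_join: "e (join q p) = f p (join q p) m" "e (join q p) = f q (join q p) (e q)"
    if q: "q \<in> J \<inter> Q" for q
    using ef[OF pJ join_J[OF q pJ]] ef[OF q join_J[OF q pJ]] e(2) by auto
  have dead: "f q r (e q) = 0" if q: "q \<in> J \<inter> Q" and r: "r \<in> Q" "r \<notin> J" "le2 q r" for q r
  proof -
    let ?j = "join q p"
    have fr: "fst r \<notin> I" "fst q \<in> I" using q r by (auto simp: J_def mem_Times_iff)
    \<comment> \<open>By convexity \<open>r\<close> can leave the band only on the right of
      \<open>x\<close>, where \<open>m\<close> is dead. This is seen at \<open>?top\<close>, and the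
      vertical map from \<open>r\<close> to it can be cancelled.\<close>
    have xr: "x < fst r"
      using convex[OF fr(2) xI, of "fst r"] fr(1) r(3) by (force simp: le2_def)
    then have "m \<in> H (fst r)" using fr(1) left_im_ge[OF p, of "fst r"] mV by (auto simp: I_def x_def)
    then have 0: "f p (fst r, y) m = 0" using xr by (simp add: H_def ker_def max_absorb2)
    let ?top = "(fst r, max (snd r) y)"
    have le: "le2 q ?j" "le2 ?j ?top" "le2 p ?j" "le2 p (fst r, y)" "le2 (fst r, y) ?top" "le2 r ?top"
      using r(3) xr by (auto simp: le2_def join_def pxy)
    have qQ: "q \<in> Q" using q by simp
    have eV: "e q \<in> V q" using hd_V[OF eh[OF q]] .
    have "f r ?top (f q r (e q)) = f q ?top (e q)" by (rule f_comp[OF qQ r(3) le(6) eV])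
    also have "\<dots> = f ?j ?top (f q ?j (e q))" by (rule f_comp[OF qQ le(1,2) eV, symmetric])
    also have "\<dots> = f ?j ?top (f p ?j m)" using e_join[OF q] by simp
    also have "\<dots> = f p ?top m" by (rule f_comp[OF p le(3,2) mV])
    also have "\<dots> = f (fst r, y) ?top (f p (fst r, y) m)" by (rule f_comp[OF p le(4,5) mV, symmetric])
    also have "\<dots> = 0" unfolding 0 by (rule f_zero[OF up[OF p le(4)] le(5)])
    finally show ?thesis
      by (rule inj[OF r(1) hdying_f[OF qQ r(3) eh[OF q]], rotated]) simp
  qed
  have alive: "e r \<notin> lower I r" if r: "r \<in> J \<inter> Q" for r
  proof
    assume low: "e r \<in> lower I r"
    define X Y where "X = max (fst r) x" and "Y = max (snd r) y"
    have j: "join r p = (X, Y)" by (simp add: join_def X_def Y_def pxy)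
    have jJ: "(X, Y) \<in> J \<inter> Q" using join_J[OF r pJ] j by simp
    then have XI: "X \<in> I" by (simp add: J_def)
    have rQ: "r \<in> Q" using r by simp
    have le: "x \<le> X" "y \<le> Y" "fst r \<le> X" "snd r \<le> Y" by (auto simp: X_def Y_def)
    have le_r: "le2 r (X, Y)" using le by (simp add: le2_def)
    have XyQ: "(X, y) \<in> Q" "(x, Y) \<in> Q" using up[OF pQ] le by auto
    \<comment> \<open>The vertical part is injective on horizontally dying elements; the horizontal
      part kills nothing at \<open>p\<close> because \<open>X\<close> belongs to
      \<open>I\<close>.\<close>
    have vanish: "z = 0" if z: "z \<in> hdying p" "f p (X, Y) z = 0" for z
    proof -
      have "f (X, y) (X, Y) (f p (X, y) z) = 0"
        using f_comp[OF p, of "(X, y)" "(X, Y)" z] z hd_V le pxy by simp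
      then have "f p (X, y) z = 0"
        using inj[OF XyQ(1) hdying_f[OF p _ z(1)], of Y] le pxy by simp
      then have "z \<in> H X" using z hd_V le by (simp add: H_def ker_def max_absorb2)
      then show ?thesis using H0[OF XI] by simp
    qed
    have e_eq: "f r (X, Y) (e r) = f p (X, Y) m" using e_join[OF r] j by simp
    have "e r \<noteq> 0"
    proof
      assume "e r = 0"
      then have "f p (X, Y) m = 0" using e_eq f_zero[OF rQ le_r] by simp
      then show False using vanish[OF mhd] m(2) by simp
    qed
    then obtain a w where a: "a \<le> fst r" "a \<notin> I" and aQ: "(a, snd r) \<in> Q"
      and w: "w \<in> V (a, snd r)" "e r = f (a, snd r) r w"
      using low by (auto simp: lower_def)
    have rI: "fst r \<in> I" using r by (auto simp: J_def mem_Times_iff)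
    have ax: "a < x" using convex[OF xI rI, of a] a by force
    let ?a = "(a, snd r)"
    have le_a: "le2 ?a (x, Y)" "le2 ?a (a, Y)" "le2 ?a r" "le2 (x, Y) (X, Y)" "le2 (a, Y) (x, Y)" "le2 p (x, Y)"
      using ax le a pxy by (auto simp: le2_def)
    \<comment> \<open>How far \<open>m\<close> and \<open>w\<close> differ over the abscissa of
      \<open>p\<close>. The difference dies at abscissa \<open>X\<close>, so it lifts to a dying
      element at \<open>p\<close>, which is zero by \<open>vanish\<close>. Hence \<open>m\<close>
      itself comes from \<open>a\<close>, contrary to \<open>a\<close> lying outside
      \<open>I\<close>.\<close>
    define \<delta> where "\<delta> = f p (x, Y) m - f ?a (x, Y) w"
    have V1: "f p (x, Y) m \<in> V (x, Y)" "f ?a (x, Y) w \<in> V (x, Y)"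
      using f_in[OF p le_a(6) mV] f_in[OF aQ le_a(1) w(1)] by auto
    have "f (x, Y) (X, Y) \<delta> = f p (X, Y) m - f ?a (X, Y) w"
      unfolding \<delta>_def f_diff[OF XyQ(2) le_a(4) V1] f_comp[OF p le_a(6,4) mV] f_comp[OF aQ le_a(1,4) w(1)] ..
    also have "f ?a (X, Y) w = f p (X, Y) m"
      using f_comp[OF aQ le_a(3) le_r w(1)] w(2) e_eq by simp
    finally have \<delta>0: "f (x, Y) (X, Y) \<delta> = 0" by simp
    have "\<delta> \<in> hdying (x, Y)"
      unfolding hdying_def using \<delta>0 le(1) diff_in[OF XyQ(2) V1] by (auto simp: \<delta>_def intro!: exI[of _ X])
    then obtain z where z: "z \<in> hdying (x, y)" "f (x, y) (x, Y) z = \<delta>"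
      by (rule hdying_vertical_surj[OF pQ le(2)])
    have "f p (X, Y) z = 0"
      using f_comp[OF p le_a(6,4), of z] \<delta>0 z hd_V pxy by simp
    then have "z = 0" using vanish z(1) pxy by simp
    then have "\<delta> = 0" using z(2) f_zero[OF pQ, of "(x, Y)"] le by simp
    then have "f p (x, Y) m = f (a, Y) (x, Y) (f ?a (a, Y) w)"
      using f_comp[OF aQ le_a(2,5) w(1)] by (simp add: \<delta>_def)
    moreover have "f ?a (a, Y) w \<in> V (a, Y)" "(a, Y) \<in> Q"
      using f_in[OF aQ le_a(2) w(1)] up[OF aQ le_a(2)] by auto
    ultimately have "m \<in> left_im p a"
      unfolding left_im_def using mV le(2) ax pxy by (auto simp: max_absorb1 intro!: exI[of _ Y])
    then show False using a(2) H_le[of a] ax m(2) by (simp add: I_def)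
  qed
  have "\<exists>e' \<pi>. block_summand s Q V f J e' \<pi>"
  proof (rule block_summandI[of J p e "lower I"])
    show "is_block J" by (rule block)
    show "p \<in> J \<inter> Q" by (rule pJ)
    show "join q r \<in> J" if "q \<in> J \<inter> Q" "r \<in> J \<inter> Q" for q r using join_J[OF that] by simp
    show "e q \<in> V q" if "q \<in> J \<inter> Q" for q by (rule hd_V[OF eh[OF that]])
    show "f q r (e q) = (if r \<in> J then e r else 0)" if "q \<in> J \<inter> Q" "r \<in> Q" "le2 q r" for q r
      using that ef[of q r] dead[of q r] by simp
    show "subspace (lower I r)" if "r \<in> J \<inter> Q" for r using that lower_subspace by simp
    show "f q r w \<in> lower I r" if "q \<in> Q - J" "r \<in> J" "le2 q r" "w \<in> V q" for q r w
      by (rule lower_out) (use that in \<open>auto simp: J_def mem_Times_iff\<close>)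
    show "f q r w \<in> lower I r" if "q \<in> J \<inter> Q" "r \<in> J" "le2 q r" "w \<in> lower I q" for q r w
      by (rule lower_f) (use that in auto)
    show "lower I r \<subseteq> V r" for r by (rule lower_sub)
    show "e r \<notin> lower I r" if "r \<in> J \<inter> Q" for r by (rule alive[OF that])
  qed
  then show ?thesis by blast
qed

end

section \<open>Injective maps\<close>

lemma is_block_swap:
  assumes "is_block J"
  shows "is_block (prod.swap -` J)"
proof -
  have Times: "prod.swap -` (X \<times> Y) = Y \<times> X" for X Y :: "real set" by auto
  from assms show ?thesis
    unfolding is_block_def[of J]
    by (elim conjE disjE exE)
      (simp_all add: Times is_block_death is_block_birth is_block_vertical is_block_horizontal)
qed

context middle_exact_module
begin

text \<open>If all maps are injective, the spaces are intersections \<open>A a \<inter> B b\<close> of the members of two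
  filtrations of their colimit; \<open>m\<close> is chosen in the smallest nonzero \<open>A a \<inter> V p\<close>.\<close>

lemma block_summand_if_injective:
  assumes inj: "\<And>q r v. q \<in> Q \<Longrightarrow> le2 q r \<Longrightarrow> v \<in> V q \<Longrightarrow> f q r v = 0 \<Longrightarrow> v = 0"
    and p: "p \<in> Q" and v: "v \<in> V p" "v \<noteq> 0"
  shows "\<exists>J e \<pi>. block_summand s Q V f J e \<pi>"
proof -
  interpret sw: middle_exact_module s "prod.swap -` Q" "V \<circ> prod.swap" "swap_maps f"
    by (rule swap_module)
  have inj': "v = w" if "q \<in> Q" "le2 q r" "v \<in> V q" "w \<in> V q" "f q r v = f q r w" for q r v w
    using inj[of q r "v - w"] that by (simp add: f_diff diff_in)
  define x y where "x = fst p" and "y = snd p"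
  have pxy: "p = (x, y)" by (simp add: x_def y_def)
  have pQ: "(x, y) \<in> Q" using p pxy by simp
  have p': "(y, x) \<in> prod.swap -` Q" using pQ by simp
  \<comment> \<open>The traces on \<open>V p\<close> of the two filtrations of the colimit, by
    abscissa and, after transposition, by height.\<close>
  define A where "A = left_im p"
  define B where "B = sw.left_im (y, x)"
  have A: "subspace (A a)" "A a \<subseteq> V p" for a
    unfolding A_def using left_im_subspace[OF p] left_im_sub by auto
  have A_mono: "A a \<subseteq> A b" if "a \<le> b" for a b
    unfolding A_def using left_im_mono[OF p that] .
  have B_mono: "B a \<subseteq> B b" if "a \<le> b" for a b
    unfolding B_def using sw.left_im_mono[OF p' that] .
  have Ax: "A x = V p" unfolding A_def using left_im_ge[OF p, of x] by (simp add: x_def)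
  have By: "B y = V p" unfolding B_def using sw.left_im_ge[OF p', of y] by (simp add: pxy)
  have "V p \<noteq> {0}" using v by blast
  obtain a0 where a0: "A a0 \<noteq> {0}" "\<And>a. A a \<noteq> {0} \<Longrightarrow> A a0 \<subseteq> A a"
  proof (rule least_nonzero[OF p, of A x])
    show "A a \<subseteq> A b \<or> A b \<subseteq> A a" for a b
      using A_mono[of a b] A_mono[of b a] linear[of a b] by blast
  qed (use A Ax \<open>V p \<noteq> {0}\<close> in auto)
  obtain m where m: "m \<in> A a0" "m \<noteq> 0" using a0(1) subspace_0[OF A(1)] by blast
  have mV: "m \<in> V p" using m A by blast
  define J1 where "J1 = {a. m \<in> A a}"
  define J2 where "J2 = {b. m \<in> B b}"
  define J where "J = J1 \<times> J2"
  have A0: "A a = {0}" if "a \<notin> J1" for a using that a0(2)[of a] m by (auto simp: J1_def)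
  have upc: "up_closed J1" "up_closed J2"
    using A_mono B_mono unfolding up_closed_def J1_def J2_def by blast+
  have xy: "x \<in> J1" "y \<in> J2" using mV Ax By by (auto simp: J1_def J2_def)
  have pJ: "p \<in> J \<inter> Q" using xy p pxy by (simp add: J_def)
  have block: "is_block J" unfolding J_def by (rule is_block_birth) (use xy upc in auto)
  have J_up: "r \<in> J" if "q \<in> J" "le2 q r" for q r
    using that upc unfolding J_def up_closed_def le2_def by (auto simp: mem_Times_iff)
  \<comment> \<open>Over high \<open>Y\<close> and far \<open>X\<close> the generator has one
    preimage at \<open>(a, Y)\<close> and one at \<open>(X, b)\<close>. They agree at
    \<open>(X, Y)\<close>, and exactness supplies a common source at \<open>(a, b)\<close>.\<close>
  have "\<exists>z\<in>V q. f q (join q p) z = f p (join q p) m" if q: "q \<in> J \<inter> Q" for q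
  proof -
    obtain a b where ab: "q = (a, b)" by (cases q)
    have abQ: "(a, b) \<in> Q" and mA: "m \<in> left_im p a" and mB: "m \<in> sw.left_im (y, x) b"
      using q by (auto simp: ab J_def J1_def J2_def A_def B_def)
    obtain Y0 where Y0: "snd p \<le> Y0" "\<And>Y. Y0 \<le> Y \<Longrightarrow> (a, Y) \<in> Q \<and>
        (\<exists>w\<in>V (a, Y). f p (max (fst p) a, Y) m = f (a, Y) (max (fst p) a, Y) w)"
      using left_im_raise[OF p mA] by blast
    obtain X0 where X0: "x \<le> X0" "\<And>X. X0 \<le> X \<Longrightarrow> (X, b) \<in> Q \<and>
        (\<exists>w\<in>V (X, b). f p (X, max y b) m = f (X, b) (X, max y b) w)"
      using sw.left_im_raise[OF p' mB] by (auto simp: pxy)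
    define X Y where "X = max X0 a" and "Y = max Y0 b"
    have XY: "X0 \<le> X" "Y0 \<le> Y" "a \<le> X" "b \<le> Y" "x \<le> X" "y \<le> Y"
      using Y0(1) X0(1) by (auto simp: X_def Y_def y_def)
    obtain w where w: "(a, Y) \<in> Q" "w \<in> V (a, Y)" "f p (max x a, Y) m = f (a, Y) (max x a, Y) w"
      using Y0(2)[OF XY(2)] by (auto simp: x_def)
    obtain w' where w': "(X, b) \<in> Q" "w' \<in> V (X, b)" "f p (X, max y b) m = f (X, b) (X, max y b) w'"
      using X0(2)[OF XY(1)] by blast
    have le: "le2 p (max x a, Y)" "le2 (max x a, Y) (X, Y)" "le2 (a, Y) (max x a, Y)"
      "le2 p (X, max y b)" "le2 (X, max y b) (X, Y)" "le2 (X, b) (X, max y b)"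
      using XY by (auto simp: pxy)
    have fw: "f (a, Y) (X, Y) w = f p (X, Y) m"
      using f_comp[OF p le(1,2) mV] f_comp[OF w(1) le(3,2) w(2)] w(3) by simp
    have fw': "f (X, b) (X, Y) w' = f p (X, Y) m"
      using f_comp[OF p le(4,5) mV] f_comp[OF w'(1) le(6,5) w'(2)] w'(3) by simp
    obtain z where z: "z \<in> V (a, b)" "f (a, b) (a, Y) z = w"
      using exact_lift[OF abQ XY(3,4) w(2) w'(2)] fw fw' by metis
    let ?j = "join q p"
    have j: "le2 ?j (X, Y)" "le2 q ?j" "le2 p ?j" using XY by (auto simp: join_def ab pxy)
    have jQ: "?j \<in> Q" using up[OF p j(3)] .
    have zV: "z \<in> V q" and qQ: "q \<in> Q" using z ab abQ by auto
    have "f ?j (X, Y) (f q ?j z) = f q (X, Y) z" by (rule f_comp[OF qQ j(2,1) zV])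
    also have "\<dots> = f (a, Y) (X, Y) w"
      using f_comp[OF abQ, of "(a, Y)" "(X, Y)" z] z XY ab by simp
    also have "\<dots> = f ?j (X, Y) (f p ?j m)"
      using fw f_comp[OF p j(3,1) mV] by simp
    finally have "f q ?j z = f p ?j m"
      using inj'[OF jQ j(1) f_in[OF qQ j(2) zV] f_in[OF p j(3) mV]] by simp
    then show ?thesis using zV by blast
  qed
  then obtain e where e: "\<And>q. q \<in> J \<inter> Q \<Longrightarrow> e q \<in> V q"
    "\<And>q. q \<in> J \<inter> Q \<Longrightarrow> f q (join q p) (e q) = f p (join q p) m" by metis
  have ef: "f q r (e q) = e r" if q: "q \<in> J \<inter> Q" and r: "r \<in> J \<inter> Q" "le2 q r" for q r
  proof -
    let ?j = "join q p" and ?k = "join r p"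
    have jk: "le2 ?j ?k" using r(2) by (auto simp: join_def le2_def)
    have qQ: "q \<in> Q" and rQ: "r \<in> Q" using q r by auto
    have "f r ?k (f q r (e q)) = f q ?k (e q)" by (rule f_comp[OF qQ r(2) _ e(1)[OF q]]) simp
    also have "\<dots> = f ?j ?k (f q ?j (e q))" by (rule f_comp[OF qQ _ jk e(1)[OF q], symmetric]) simp
    also have "\<dots> = f ?j ?k (f p ?j m)" using e(2)[OF q] by simp
    also have "\<dots> = f p ?k m" by (rule f_comp[OF p _ jk mV]) simp
    also have "\<dots> = f r ?k (e r)" using e(2)[OF r(1)] by simp
    finally show ?thesis
      by (rule inj'[OF rQ _ f_in[OF qQ r(2) e(1)[OF q]] e(1)[OF r(1)], rotated]) simp
  qed
  \<comment> \<open>A point outside the block has its abscissa outside \<open>J1\<close> or its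
    height outside \<open>J2\<close>, so what enters comes from the left or from below.\<close>
  define L where "L r = {a + b |a b. a \<in> lower J1 r \<and> b \<in> sw.lower J2 (prod.swap r)}" for r
  have lower2_sub: "sw.lower J2 (prod.swap r) \<subseteq> V r" for r using sw.lower_sub[of J2 "prod.swap r"] by simp
  have low0: "0 \<in> lower J1 r" "0 \<in> sw.lower J2 (prod.swap r)" if "r \<in> Q" for r
    using subspace_0 lower_subspace[OF that] sw.lower_subspace[of "prod.swap r"] that by auto
  have L_lower: "w \<in> L r" if "r \<in> Q" "w \<in> lower J1 r \<or> w \<in> sw.lower J2 (prod.swap r)" for w r
    using that(2) low0[OF that(1)] unfolding L_def by force
  have eL: "e r \<notin> L r" if r: "r \<in> J \<inter> Q" for r
  proof
    assume "e r \<in> L r"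
    then obtain \<alpha> \<beta> where \<alpha>\<beta>: "e r = \<alpha> + \<beta>" "\<alpha> \<in> lower J1 r" "\<beta> \<in> sw.lower J2 (prod.swap r)"
      unfolding L_def by blast
    have rQ: "r \<in> Q" using r by simp
    define X Y where "X = max (fst r) x" and "Y = max (snd r) y"
    have j: "join r p = (X, Y)" by (simp add: join_def X_def Y_def pxy)
    have rXY: "le2 r (X, Y)" using le2_join(1)[of r p] j by simp
    have XY: "x \<le> X" "y \<le> Y" by (auto simp: X_def Y_def)
    have XYQ: "(X, Y) \<in> Q" "(x, Y) \<in> Q" "(X, y) \<in> Q" using up[OF pQ] XY by auto
    have sum: "f p (X, Y) m = f r (X, Y) \<alpha> + f r (X, Y) \<beta>"
      using e(2)[OF r] j \<alpha>\<beta> f_add[OF rQ rXY, of \<alpha> \<beta>] lower_sub[of J1 r] lower2_sub[of r] by auto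
    \<comment> \<open>An abscissa outside \<open>J1\<close> is also to the left of \<open>p\<close>,
      so the part coming from the left already exists over the abscissa of \<open>p\<close>.\<close>
    have "\<exists>a1\<in>V (x, Y). f (x, Y) (X, Y) a1 = f r (X, Y) \<alpha> \<and>
      (a1 = 0 \<or> (\<exists>a\<le>x. a \<notin> J1 \<and> (a, Y) \<in> Q \<and> (\<exists>w\<in>V (a, Y). a1 = f (a, Y) (x, Y) w)))"
    proof -
      have "f r (X, Y) \<alpha> \<in> lower J1 (X, Y)" by (rule lower_f[OF rQ rXY \<alpha>\<beta>(2)])
      then consider "f r (X, Y) \<alpha> = 0" | a w where "a \<le> X" "a \<notin> J1" "(a, Y) \<in> Q" "w \<in> V (a, Y)"
        "f r (X, Y) \<alpha> = f (a, Y) (X, Y) w" by (auto simp: lower_def)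
      then show ?thesis
      proof cases
        case 1
        then show ?thesis using XY XYQ by (intro bexI[of _ 0]) auto
      next
        case 2
        have ax: "a \<le> x" using 2(2) xy(1) upc(1) unfolding up_closed_def by (meson linorder_le_cases)
        have "f (x, Y) (X, Y) (f (a, Y) (x, Y) w) = f r (X, Y) \<alpha>"
          using f_comp[OF 2(3), of "(x, Y)" "(X, Y)" w] 2 ax XY by simp
        moreover have "f (a, Y) (x, Y) w \<in> V (x, Y)" using f_in[OF 2(3) _ 2(4)] ax by simp
        ultimately show ?thesis using 2 ax by blast
      qed
    qed
    then obtain a1 where a1: "a1 \<in> V (x, Y)" "f (x, Y) (X, Y) a1 = f r (X, Y) \<alpha>"
      "a1 = 0 \<or> (\<exists>a\<le>x. a \<notin> J1 \<and> (a, Y) \<in> Q \<and> (\<exists>w\<in>V (a, Y). a1 = f (a, Y) (x, Y) w))" by blast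
    have "\<exists>b1\<in>V (X, y). f (X, y) (X, Y) b1 = f r (X, Y) \<beta> \<and>
      (b1 = 0 \<or> (\<exists>b\<le>y. b \<notin> J2 \<and> (X, b) \<in> Q \<and> (\<exists>w\<in>V (X, b). b1 = f (X, b) (X, y) w)))"
    proof -
      have "swap_maps f (prod.swap r) (Y, X) \<beta> \<in> sw.lower J2 (Y, X)"
        by (rule sw.lower_f[OF _ _ \<alpha>\<beta>(3)]) (use rQ rXY in \<open>auto simp: le2_def\<close>)
      then consider "f r (X, Y) \<beta> = 0" | b w where "b \<le> Y" "b \<notin> J2" "(X, b) \<in> Q" "w \<in> V (X, b)"
        "f r (X, Y) \<beta> = f (X, b) (X, Y) w" by (auto simp: sw.lower_def)
      then show ?thesis
      proof cases
        case 1
        then show ?thesis using XY XYQ by (intro bexI[of _ 0]) auto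
      next
        case 2
        have bY: "b \<le> y" using 2(2) xy(2) upc(2) unfolding up_closed_def by (meson linorder_le_cases)
        have "f (X, y) (X, Y) (f (X, b) (X, y) w) = f r (X, Y) \<beta>"
          using f_comp[OF 2(3), of "(X, y)" "(X, Y)" w] 2 bY XY by simp
        moreover have "f (X, b) (X, y) w \<in> V (X, y)" using f_in[OF 2(3) _ 2(4)] bY by simp
        ultimately show ?thesis using 2 bY by blast
      qed
    qed
    then obtain b1 where b1: "b1 \<in> V (X, y)" "f (X, y) (X, Y) b1 = f r (X, Y) \<beta>"
      "b1 = 0 \<or> (\<exists>b\<le>y. b \<notin> J2 \<and> (X, b) \<in> Q \<and> (\<exists>w\<in>V (X, b). b1 = f (X, b) (X, y) w))" by blast
    have pX: "le2 p (X, y)" "le2 (X, y) (X, Y)" using XY pxy by auto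
    have mX: "f p (X, y) m \<in> V (X, y)" by (rule f_in[OF p pX(1) mV])
    have "f (x, Y) (X, Y) a1 = f (X, y) (X, Y) (f p (X, y) m - b1)"
      using f_diff[OF XYQ(3) pX(2) mX b1(1)] f_comp[OF p pX mV] a1(2) b1(2) sum by simp
    \<comment> \<open>At \<open>(X, Y)\<close> the element \<open>m\<close> is the sum of
      \<open>a1\<close> and \<open>b1\<close>, so \<open>a1\<close> and \<open>m - b1\<close> agree
      there and have a common source \<open>z\<close> at \<open>p\<close>.\<close>
    then obtain z where z: "z \<in> V (x, y)" "f (x, y) (x, Y) z = a1" "f (x, y) (X, y) z = f p (X, y) m - b1"
      using exact_lift[OF pQ XY a1(1) diff_in[OF XYQ(3) mX b1(1)]] by metis
    have "z = 0"
      using a1(3)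
    proof
      assume "a1 = 0"
      then show ?thesis using inj[OF pQ _ z(1), of "(x, Y)"] z XY by simp
    next
      assume "\<exists>a\<le>x. a \<notin> J1 \<and> (a, Y) \<in> Q \<and> (\<exists>w\<in>V (a, Y). a1 = f (a, Y) (x, Y) w)"
      then obtain a w where a: "a \<le> x" "a \<notin> J1" "(a, Y) \<in> Q" "w \<in> V (a, Y)" "a1 = f (a, Y) (x, Y) w" by blast
      then have "z \<in> A a"
        using z XY unfolding A_def left_im_def by (auto simp: pxy max_absorb1 intro!: exI[of _ Y])
      then show ?thesis using A0[OF a(2)] by simp
    qed
    \<comment> \<open>With the left part gone, \<open>m\<close> would come entirely from a height
      outside \<open>J2\<close>, against the definition of \<open>J2\<close>.\<close>
    then have mb: "f p (X, y) m = b1" using z(3) XY pQ by simp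
    show False
      using b1(3)
    proof
      assume "b1 = 0"
      then show False using inj[OF p pX(1) mV] mb m(2) by simp
    next
      assume "\<exists>b\<le>y. b \<notin> J2 \<and> (X, b) \<in> Q \<and> (\<exists>w\<in>V (X, b). b1 = f (X, b) (X, y) w)"
      then obtain b w where b: "b \<le> y" "b \<notin> J2" "(X, b) \<in> Q" "w \<in> V (X, b)" "b1 = f (X, b) (X, y) w" by blast
      then have "m \<in> B b"
        using mb mV XY unfolding B_def sw.left_im_def by (auto simp: pxy max_absorb1 intro!: exI[of _ X])
      then show False using b(2) by (simp add: J2_def)
    qed
  qed
  have "\<exists>e' \<pi>. block_summand s Q V f J e' \<pi>"
  proof (rule block_summandI[of J p e L])
    show "is_block J" by (rule block)
    show "p \<in> J \<inter> Q" by (rule pJ)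
    show "join q r \<in> J" if "q \<in> J \<inter> Q" for q r using J_up[of q "join q r"] that by simp
    show "f q r (e q) = (if r \<in> J then e r else 0)" if "q \<in> J \<inter> Q" "r \<in> Q" "le2 q r" for q r
      using that ef[of q r] J_up[of q r] by simp
    show "subspace (L r)" if "r \<in> J \<inter> Q" for r
      unfolding L_def by (rule subspace_sums[OF lower_subspace sw.lower_subspace]) (use that in auto)
    show "f q r w \<in> L r" if q: "q \<in> Q - J" "r \<in> J" "le2 q r" "w \<in> V q" for q r w
    proof (rule L_lower)
      show "r \<in> Q" using up[of q r] q by simp
      show "f q r w \<in> lower J1 r \<or> f q r w \<in> sw.lower J2 (prod.swap r)"
        using q lower_out[of q J1 r w] sw.lower_out[of "prod.swap q" J2 "prod.swap r" w]
        by (auto simp: J_def mem_Times_iff)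
    qed
    show "f q r w \<in> L r" if q: "q \<in> J \<inter> Q" "r \<in> J" "le2 q r" "w \<in> L q" for q r w
    proof -
      obtain \<alpha> \<beta> where \<alpha>\<beta>: "w = \<alpha> + \<beta>" "\<alpha> \<in> lower J1 q" "\<beta> \<in> sw.lower J2 (prod.swap q)"
        using q(4) unfolding L_def by blast
      have qQ: "q \<in> Q" using q by simp
      have "f q r w = f q r \<alpha> + f q r \<beta>"
        unfolding \<alpha>\<beta>(1) by (rule f_add[OF qQ q(3)]) (use \<alpha>\<beta> lower_sub[of J1 q] lower2_sub[of q] in auto)
      moreover have "f q r \<alpha> \<in> lower J1 r" by (rule lower_f[OF qQ q(3) \<alpha>\<beta>(2)])
      moreover have "f q r \<beta> \<in> sw.lower J2 (prod.swap r)"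
        using sw.lower_f[OF _ _ \<alpha>\<beta>(3), of "prod.swap r"] qQ q(3) by simp
      ultimately show ?thesis unfolding L_def by blast
    qed
    show "L r \<subseteq> V r" if "r \<in> J \<inter> Q" for r
      using that lower_sub[of J1 r] lower2_sub[of r] add_in[of r] unfolding L_def by blast
  qed (use e(1) eL in auto)
  then show ?thesis by blast
qed

section \<open>Transposed summands and the case distinction\<close>

lemma block_summand_swap:
  assumes "block_summand s (prod.swap -` Q) (V \<circ> prod.swap) (swap_maps f) J e \<pi>"
  shows "block_summand s Q V f (prod.swap -` J) (e \<circ> prod.swap) (\<pi> \<circ> prod.swap)"
proof -
  have b: "is_block J" "J \<inter> prod.swap -` Q \<noteq> {}" using assms by (auto simp: block_summand_def)
  obtain q where "q \<in> J" "prod.swap q \<in> Q" using b(2) by auto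
  then have "prod.swap q \<in> prod.swap -` J \<inter> Q" by simp
  then have "prod.swap -` J \<inter> Q \<noteq> {}" by blast
  moreover have "is_block (prod.swap -` J)" by (rule is_block_swap[OF b(1)])
  moreover have 1: "\<And>p. p \<in> prod.swap -` Q \<Longrightarrow> e p \<in> (V \<circ> prod.swap) p \<and> (p \<notin> J \<longrightarrow> e p = 0) \<and> (p \<in> J \<longrightarrow> \<pi> p (e p) = 1) \<and>
        (\<forall>v\<in>(V \<circ> prod.swap) p. (p \<notin> J \<longrightarrow> \<pi> p v = 0) \<and> (\<forall>w\<in>(V \<circ> prod.swap) p. \<pi> p (v + w) = \<pi> p v + \<pi> p w) \<and>
           (\<forall>a. \<pi> p (s a v) = a * \<pi> p v))"
    and 2: "\<And>p q. p \<in> prod.swap -` Q \<Longrightarrow> q \<in> prod.swap -` Q \<Longrightarrow> le2 p q \<Longrightarrow> (p \<in> J \<longrightarrow> swap_maps f p q (e p) = e q) \<and>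
        (q \<in> J \<longrightarrow> (\<forall>v\<in>(V \<circ> prod.swap) p. \<pi> q (swap_maps f p q v) = \<pi> p v))"
    using assms by (simp_all add: block_summand_def)
  ultimately show ?thesis
    unfolding block_summand_def
  proof (intro conjI ballI impI)
    fix p assume "p \<in> Q"
    note * = 1[of "prod.swap p"]
    show "(e \<circ> prod.swap) p \<in> V p" "p \<notin> prod.swap -` J \<Longrightarrow> (e \<circ> prod.swap) p = 0"
      "p \<in> prod.swap -` J \<Longrightarrow> (\<pi> \<circ> prod.swap) p ((e \<circ> prod.swap) p) = 1"
      using * \<open>p \<in> Q\<close> by auto
    fix v assume "v \<in> V p"
    then show "p \<notin> prod.swap -` J \<Longrightarrow> (\<pi> \<circ> prod.swap) p v = 0"
      "\<forall>a. (\<pi> \<circ> prod.swap) p (s a v) = a * (\<pi> \<circ> prod.swap) p v"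
      using * \<open>p \<in> Q\<close> by auto
    show "(\<pi> \<circ> prod.swap) p (v + w) = (\<pi> \<circ> prod.swap) p v + (\<pi> \<circ> prod.swap) p w" if "w \<in> V p" for w
      using * \<open>p \<in> Q\<close> \<open>v \<in> V p\<close> that by auto
  next
    fix p q assume "p \<in> Q" "q \<in> Q" "le2 p q"
    note * = 2[of "prod.swap p" "prod.swap q"]
    show "p \<in> prod.swap -` J \<Longrightarrow> f p q ((e \<circ> prod.swap) p) = (e \<circ> prod.swap) q"
      using * \<open>p \<in> Q\<close> \<open>q \<in> Q\<close> \<open>le2 p q\<close> by auto
    show "(\<pi> \<circ> prod.swap) q (f p q v) = (\<pi> \<circ> prod.swap) p v" if "q \<in> prod.swap -` J" "v \<in> V p" for v
      using * that \<open>p \<in> Q\<close> \<open>q \<in> Q\<close> \<open>le2 p q\<close> by auto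
  qed
qed

theorem block_summand_exists:
  assumes p: "p \<in> Q" and v: "v \<in> V p" "v \<noteq> 0"
  shows "\<exists>J e \<pi>. block_summand s Q V f J e \<pi>"
proof (rule ccontr)
  assume none: "\<nexists>J e \<pi>. block_summand s Q V f J e \<pi>"
  interpret sw: middle_exact_module s "prod.swap -` Q" "V \<circ> prod.swap" "swap_maps f"
    by (rule swap_module)
  have sw_none: "\<nexists>J e \<pi>. block_summand s (prod.swap -` Q) (V \<circ> prod.swap) (swap_maps f) J e \<pi>"
    using none block_summand_swap by blast
  have double: "w = 0" if "q \<in> Q" "w \<in> V q" "fst q \<le> a" "f q (a, snd q) w = 0"
    "snd q \<le> b" "f q (fst q, b) w = 0" for q w a b
    using block_summand_if_doubly_dying[OF that(1,2) _ that(3-6)] none by blast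
  have hinj: "w = 0" if q: "q \<in> Q" "w \<in> V q" "fst q \<le> a" "f q (a, snd q) w = 0" for q w a
  proof (rule ccontr)
    assume "w \<noteq> 0"
    moreover have "w \<in> hdying q" using q by (auto simp: hdying_def)
    moreover have "u = 0" if "r \<in> Q" "u \<in> hdying r" "snd r \<le> b" "f r (fst r, b) u = 0" for r u b
      using double[OF that(1) _ _ _ that(3,4)] that(2) by (auto simp: hdying_def)
    ultimately show False using block_summand_if_horizontally_dying[of q w] q(1) none by blast
  qed
  have vinj: "w = 0" if q: "q \<in> Q" "w \<in> V q" "snd q \<le> b" "f q (fst q, b) w = 0" for q w b
  proof (rule ccontr)
    assume "w \<noteq> 0"
    moreover have "w \<in> sw.hdying (prod.swap q)" using q by (auto simp: sw.hdying_def)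
    \<comment> \<open>In the transposed module the maps that have to be injective are the original
      horizontal ones, for which \<open>hinj\<close> is already available.\<close>
    moreover have "u = 0" if r: "r \<in> prod.swap -` Q" "u \<in> sw.hdying r" "snd r \<le> b"
      "swap_maps f r (fst r, b) u = 0" for r u b
      using hinj[of "prod.swap r" u b] r by (auto simp: sw.hdying_def)
    ultimately show False
      using sw.block_summand_if_horizontally_dying[of "prod.swap q" w] q(1) sw_none by auto
  qed
  \<comment> \<open>Every structure map is a horizontal map followed by a vertical one.\<close>
  have "w = 0" if q: "q \<in> Q" "le2 q r" "w \<in> V q" "f q r w = 0" for q r w
  proof -
    let ?j = "(fst r, snd q)"
    have le: "le2 q ?j" "le2 ?j r" using q(2) by (auto simp: le2_def)
    have "f ?j r (f q ?j w) = 0" using f_comp[OF q(1) le q(3)] q(4) by simp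
    then have "f q ?j w = 0"
      using vinj[OF up[OF q(1) le(1)] f_in[OF q(1) le(1) q(3)], of "snd r"] le(2) by (simp add: le2_def)
    then show ?thesis using hinj[OF q(1,3), of "fst r"] q(2) by (simp add: le2_def)
  qed
  then show False using block_summand_if_injective[OF _ p v] none by blast
qed

end

section \<open>Orthogonal families of summands\<close>

definition summand_at :: "((real \<times> real) set \<times> (real \<times> real \<Rightarrow> 'v) \<times> (real \<times> real \<Rightarrow> 'v \<Rightarrow> 'k)) set \<Rightarrow>
   real \<times> real \<Rightarrow> ((real \<times> real) set \<times> (real \<times> real \<Rightarrow> 'v) \<times> (real \<times> real \<Rightarrow> 'v \<Rightarrow> 'k)) set" where
  "summand_at \<F> p = {t \<in> \<F>. p \<in> fst t}"

abbreviation (input) gen where "gen t \<equiv> fst (snd t)"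
abbreviation (input) coord where "coord t \<equiv> snd (snd t)"

text \<open>Members are triples of block, generator and coordinate. Orthogonality is required for
  both orders of a pair, so the coordinates are dual to the generators.\<close>

locale orthogonal_summands = middle_exact_module s Q V f
  for s :: "'k::field \<Rightarrow> 'v::ab_group_add \<Rightarrow> 'v" and Q V f +
  fixes \<F> :: "((real \<times> real) set \<times> (real \<times> real \<Rightarrow> 'v) \<times> (real \<times> real \<Rightarrow> 'v \<Rightarrow> 'k)) set"
  assumes summand: "t \<in> \<F> \<Longrightarrow> block_summand s Q V f (fst t) (gen t) (coord t)"
    and orthogonal: "t \<in> \<F> \<Longrightarrow> t' \<in> \<F> \<Longrightarrow> t \<noteq> t' \<Longrightarrow> p \<in> Q \<Longrightarrow> coord t p (gen t' p) = 0"
begin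

lemma gen_in: "t \<in> \<F> \<Longrightarrow> p \<in> Q \<Longrightarrow> gen t p \<in> V p"
  using summand unfolding block_summand_def by blast

lemma gen_out: "t \<in> \<F> \<Longrightarrow> p \<in> Q \<Longrightarrow> p \<notin> fst t \<Longrightarrow> gen t p = 0"
  using summand unfolding block_summand_def by blast

lemma gen_f: "t \<in> \<F> \<Longrightarrow> p \<in> Q \<Longrightarrow> le2 p q \<Longrightarrow> p \<in> fst t \<Longrightarrow> f p q (gen t p) = gen t q"
  using summand up[of p q] unfolding block_summand_def by blast

lemma coord_gen: "t \<in> \<F> \<Longrightarrow> p \<in> Q \<Longrightarrow> p \<in> fst t \<Longrightarrow> coord t p (gen t p) = 1"
  using summand unfolding block_summand_def by blast

lemma coord_out: "t \<in> \<F> \<Longrightarrow> p \<in> Q \<Longrightarrow> p \<notin> fst t \<Longrightarrow> v \<in> V p \<Longrightarrow> coord t p v = 0"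
  using summand unfolding block_summand_def by blast

lemma coord_add: "t \<in> \<F> \<Longrightarrow> p \<in> Q \<Longrightarrow> v \<in> V p \<Longrightarrow> w \<in> V p \<Longrightarrow> coord t p (v + w) = coord t p v + coord t p w"
  using summand unfolding block_summand_def by blast

lemma coord_scale: "t \<in> \<F> \<Longrightarrow> p \<in> Q \<Longrightarrow> v \<in> V p \<Longrightarrow> coord t p (s a v) = a * coord t p v"
  using summand unfolding block_summand_def by blast

lemma coord_f: "t \<in> \<F> \<Longrightarrow> p \<in> Q \<Longrightarrow> le2 p q \<Longrightarrow> q \<in> fst t \<Longrightarrow> v \<in> V p \<Longrightarrow> coord t q (f p q v) = coord t p v"
  using summand up[of p q] unfolding block_summand_def by blast

lemma coord_zero: "t \<in> \<F> \<Longrightarrow> p \<in> Q \<Longrightarrow> coord t p 0 = 0"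
  using coord_scale[of t p 0 0] by simp

lemma coord_diff: "t \<in> \<F> \<Longrightarrow> p \<in> Q \<Longrightarrow> v \<in> V p \<Longrightarrow> w \<in> V p \<Longrightarrow> coord t p (v - w) = coord t p v - coord t p w"
  using coord_add[of t p "v - w" w] diff_in[of p v w] by simp

lemma coord_sum:
  assumes "t \<in> \<F>" "p \<in> Q" "\<And>i. i \<in> A \<Longrightarrow> g i \<in> V p"
  shows "coord t p (\<Sum>i\<in>A. g i) = (\<Sum>i\<in>A. coord t p (g i))"
  using assms(3)
  by (induction A rule: infinite_finite_induct)
    (auto simp: coord_zero coord_add assms(1,2) sub subspace_sum)

text \<open>The coordinate of \<open>t\<close> vanishes on every other generator and is 1 on its
  own, so the generators whose blocks contain \<open>p\<close> are distinct and independent in a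
  finite-dimensional space.\<close>

lemma finite_summand_at:
  assumes p: "p \<in> Q"
  shows "finite (summand_at \<F> p)"
proof -
  let ?g = "\<lambda>t. gen t p"
  have t: "t \<in> \<F>" "p \<in> fst t" if "t \<in> summand_at \<F> p" for t using that by (auto simp: summand_at_def)
  have inj: "inj_on ?g (summand_at \<F> p)"
  proof (rule inj_onI, rule ccontr)
    fix t t' assume tt: "t \<in> summand_at \<F> p" "t' \<in> summand_at \<F> p" "?g t = ?g t'" "t \<noteq> t'"
    have "coord t p (?g t) = 1" by (rule coord_gen[OF t(1)[OF tt(1)] p t(2)[OF tt(1)]])
    moreover have "coord t p (?g t') = 0" by (rule orthogonal[OF t(1)[OF tt(1)] t(1)[OF tt(2)] tt(4) p])
    ultimately show False using tt(3) by simp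
  qed
  have "independent (?g ` summand_at \<F> p)"
    unfolding dependent_def
  proof
    assume "\<exists>a\<in>?g ` summand_at \<F> p. a \<in> span (?g ` summand_at \<F> p - {a})"
    then obtain t where tt: "t \<in> summand_at \<F> p" "?g t \<in> span (?g ` summand_at \<F> p - {?g t})" by blast
    note tF = t(1)[OF tt(1)]
    let ?K = "{v \<in> V p. coord t p v = 0}"
    have "subspace ?K"
      by (rule subspaceI) (use p tF in \<open>auto simp: coord_zero coord_add coord_scale add_in scale_in\<close>)
    moreover have "?g ` summand_at \<F> p - {?g t} \<subseteq> ?K"
      using t gen_in[OF _ p] orthogonal[OF tF _ _ p] by blast
    ultimately have "?g t \<in> ?K" using tt(2) span_minimal by blast
    then show False using coord_gen[OF tF p t(2)[OF tt(1)]] by simp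
  qed
  moreover have "?g ` summand_at \<F> p \<subseteq> V p" using t gen_in[OF _ p] by blast
  ultimately have "finite (?g ` summand_at \<F> p)"
    using fin_dimE[OF p] independent_span_bound by metis
  then show ?thesis using inj by (rule finite_imageD)
qed

definition compl :: "real \<times> real \<Rightarrow> 'v set" where
  "compl p = {v \<in> V p. \<forall>t\<in>\<F>. coord t p v = 0}"

text \<open>The projection onto the sum of all the summands at \<open>p\<close>, along
  \<open>compl p\<close>.\<close>

definition comb :: "real \<times> real \<Rightarrow> 'v \<Rightarrow> 'v" where
  "comb p v = (\<Sum>t\<in>summand_at \<F> p. s (coord t p v) (gen t p))"

lemma coord_comb:
  assumes "t \<in> \<F>" "p \<in> Q"
  shows "coord t p (\<Sum>u\<in>summand_at \<F> p. s (c u) (gen u p)) = (if p \<in> fst t then c t else 0)"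
proof -
  have V: "gen u p \<in> V p" if "u \<in> summand_at \<F> p" for u
    using that assms gen_in by (auto simp: summand_at_def)
  have "coord t p (\<Sum>u\<in>summand_at \<F> p. s (c u) (gen u p)) =
    (\<Sum>u\<in>summand_at \<F> p. coord t p (s (c u) (gen u p)))"
    by (rule coord_sum[OF assms]) (use V assms scale_in in auto)
  also have "\<dots> = (\<Sum>u\<in>summand_at \<F> p. if u = t then c t else 0)"
  proof (rule sum.cong)
    fix u assume u: "u \<in> summand_at \<F> p"
    then have "u \<in> \<F>" "p \<in> fst u" by (auto simp: summand_at_def)
    then show "coord t p (s (c u) (gen u p)) = (if u = t then c t else 0)"
      using coord_scale[OF assms V[OF u]] coord_gen[of u p] orthogonal[of t u p] assms by (cases "u = t") auto
  qed simp
  also have "\<dots> = (if p \<in> fst t then c t else 0)"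
    using finite_summand_at[OF assms(2)] assms(1) by (simp add: summand_at_def)
  finally show ?thesis .
qed

lemma comb_in: "p \<in> Q \<Longrightarrow> comb p v \<in> V p"
  unfolding comb_def by (intro subspace_sum sub scale_in gen_in) (auto simp: summand_at_def)

text \<open>The two sums run over different sets of blocks. A block left on the way has zero
  generator at \<open>q\<close>; for a block entered on the way the coordinate at \<open>p\<close>
  is zero.\<close>

lemma comb_f:
  assumes "p \<in> Q" "le2 p q" "v \<in> V p"
  shows "f p q (comb p v) = comb q (f p q v)"
proof -
  have q: "q \<in> Q" using up assms by blast
  let ?A = "summand_at \<F> p" and ?B = "summand_at \<F> q"
  have V: "gen t p \<in> V p" if "t \<in> ?A" for t using that assms gen_in by (auto simp: summand_at_def)
  have "f p q (comb p v) = (\<Sum>t\<in>?A. f p q (s (coord t p v) (gen t p)))"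
    unfolding comb_def by (rule f_sum[OF assms(1,2)]) (use V assms scale_in in auto)
  also have "\<dots> = (\<Sum>t\<in>?A. s (coord t p v) (gen t q))"
    by (rule sum.cong) (use V assms in \<open>auto simp: f_scale gen_f summand_at_def\<close>)
  also have "\<dots> = (\<Sum>t\<in>?A \<inter> ?B. s (coord t p v) (gen t q))"
    by (rule sum.mono_neutral_right)
      (use finite_summand_at[OF assms(1)] gen_out[OF _ q] in \<open>auto simp: summand_at_def\<close>)
  also have "\<dots> = (\<Sum>t\<in>?B. s (coord t p v) (gen t q))"
    by (rule sum.mono_neutral_left)
      (use finite_summand_at[OF q] coord_out[OF _ assms(1) _ assms(3)] in \<open>auto simp: summand_at_def\<close>)
  also have "\<dots> = comb q (f p q v)"
    unfolding comb_def
    by (rule sum.cong) (use assms coord_f in \<open>auto simp: summand_at_def\<close>)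
  finally show ?thesis .
qed

lemma comb_compl: "v \<in> compl p \<Longrightarrow> comb p v = 0"
  unfolding comb_def compl_def by (rule sum.neutral) (auto simp: summand_at_def)

lemma compl_proj:
  assumes "p \<in> Q" "v \<in> V p"
  shows "v - comb p v \<in> compl p"
proof -
  have "coord t p (v - comb p v) = 0" if t: "t \<in> \<F>" for t
    using coord_diff[OF t assms(1,2) comb_in[OF assms(1)], of v] coord_comb[OF t assms(1), of "\<lambda>t. coord t p v"]
      coord_out[OF t assms(1) _ assms(2)]
    unfolding comb_def by (simp split: if_splits)
  then show ?thesis using diff_in comb_in assms by (simp add: compl_def)
qed

lemma compl_f: "p \<in> Q \<Longrightarrow> le2 p q \<Longrightarrow> v \<in> compl p \<Longrightarrow> f p q v \<in> compl q"
proof -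
  assume *: "p \<in> Q" "le2 p q" "v \<in> compl p"
  then have q: "q \<in> Q" and v: "v \<in> V p" using up by (auto simp: compl_def)
  have "coord t q (f p q v) = 0" if t: "t \<in> \<F>" for t
    using coord_f[OF t *(1,2) _ v] coord_out[OF t q _ f_in[OF *(1,2) v]] *(3) t
    by (cases "q \<in> fst t") (auto simp: compl_def)
  then show ?thesis using f_in[OF *(1,2) v] by (simp add: compl_def)
qed

text \<open>\<open>compl\<close> is the kernel of a natural projection, hence a direct summand of
  the module, and exactness passes to direct summands.\<close>

lemma compl_module: "middle_exact_module s Q compl f"
proof unfold_locales
  have CV: "\<And>p v. v \<in> compl p \<Longrightarrow> v \<in> V p" by (simp add: compl_def)
  have sub: "subspace (compl p)" if p: "p \<in> Q" for p
    by (rule subspaceI) (use p in \<open>auto simp: compl_def coord_zero coord_add coord_scale add_in scale_in\<close>)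
  show "q \<in> Q" if "p \<in> Q" "le2 p q" for p q using that by (rule up)
  show "\<exists>c. (\<forall>x. (x, c - x) \<in> Q) \<and> (\<forall>q\<in>F. c \<le> fst q + snd q)" if "finite F" "F \<subseteq> Q" for F
    using that by (rule antidiagonal)
  show "pers_module s Q compl f"
    unfolding pers_module_def
    using vector_space_axioms sub compl_f CV by (auto simp: f_add f_scale f_comp)
  show "pointwise_fin_dim s Q compl"
    unfolding pointwise_fin_dim_def
  proof
    fix p assume p: "p \<in> Q"
    obtain B where B: "B \<subseteq> compl p" "independent B" "compl p \<subseteq> span B"
      using maximal_independent_subset by blast
    have BV: "B \<subseteq> V p" using B(1) CV by blast
    have "finite B" using fin_dimE[OF p] independent_span_bound[OF _ B(2)] BV by metis
    moreover have "span B = compl p" using B sub[OF p] by (simp add: span_subspace)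
    ultimately show "\<exists>B. finite B \<and> B \<subseteq> compl p \<and> span B = compl p" using B(1) by blast
  qed
  show "middle_exact Q compl f"
    unfolding middle_exact_def
  proof (intro allI impI ballI iffI)
    fix x x' y y' u w
    assume *: "x \<le> x' \<and> y \<le> y' \<and> (x, y) \<in> Q \<and> (x, y') \<in> Q \<and> (x', y) \<in> Q \<and> (x', y') \<in> Q"
      and u: "u \<in> compl (x, y')" and w: "w \<in> compl (x', y)"
    have a: "(x, y) \<in> Q" "x \<le> x'" "y \<le> y'" using * by auto
    { assume "f (x, y') (x', y') u - f (x', y) (x', y') w = 0"
      then obtain z where z: "z \<in> V (x, y)" "f (x, y) (x, y') z = u" "f (x, y) (x', y) z = w"
        using exact_lift[OF a CV[OF u] CV[OF w]] by auto
      \<comment> \<open>Subtracting the projection moves the lift into \<open>compl\<close> and, by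
        naturality, leaves its images unchanged, as these already lie in
        \<open>compl\<close>.\<close>
      let ?z = "z - comb (x, y) z"
      have "f (x, y) (x, y') ?z = u"
        using f_diff[OF a(1) _ z(1) comb_in[OF a(1)], of "(x, y')" z] comb_f[OF a(1) _ z(1), of "(x, y')"]
          a z(2) comb_compl[OF u] by simp
      moreover have "f (x, y) (x', y) ?z = w"
        using f_diff[OF a(1) _ z(1) comb_in[OF a(1)], of "(x', y)" z] comb_f[OF a(1) _ z(1), of "(x', y)"]
          a z(3) comb_compl[OF w] by simp
      ultimately show "\<exists>z\<in>compl (x, y). f (x, y) (x, y') z = u \<and> f (x, y) (x', y) z = w"
        using compl_proj[OF a(1) z(1)] by blast }
    { assume "\<exists>z\<in>compl (x, y). f (x, y) (x, y') z = u \<and> f (x, y) (x', y) z = w"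
      then obtain z where z: "z \<in> V (x, y)" "f (x, y) (x, y') z = u" "f (x, y) (x', y) z = w"
        using CV by blast
      show "f (x, y') (x', y') u - f (x', y) (x', y') w = 0"
        using f_comp[OF a(1) _ _ z(1), of "(x, y')" "(x', y')"] f_comp[OF a(1) _ _ z(1), of "(x', y)" "(x', y')"]
          a z(2,3) by simp }
  qed
qed

text \<open>A block split off from the common kernel is orthogonal to the family: its generator is
  killed by all old coordinates, and its coordinate, composed with the projection to the kernel,
  kills all old generators.\<close>

lemma extend_orthogonal:
  assumes p: "p \<in> Q" and v: "v \<in> compl p" "v \<noteq> 0"
  shows "\<exists>t. t \<notin> \<F> \<and> orthogonal_summands s Q V f (insert t \<F>)"
proof -
  interpret C: middle_exact_module s Q compl f by (rule compl_module)
  obtain J e \<rho> where "block_summand s Q compl f J e \<rho>"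
    using C.block_summand_exists[OF p v] by blast
  \<comment> \<open>Viewed as a one-member family, the new summand inherits the rules for generators
    and coordinates.\<close>
  then interpret E: orthogonal_summands s Q compl f "{(J, e, \<rho>)}"
    by unfold_locales auto
  define \<pi> where "\<pi> q w = \<rho> q (w - comb q w)" for q w
  define t where "t = (J, e, \<pi>)"
  have comb_add: "comb q (v + w) = comb q v + comb q w" if "q \<in> Q" "v \<in> V q" "w \<in> V q" for q v w
    unfolding comb_def sum.distrib[symmetric]
    by (rule sum.cong) (use that in \<open>auto simp: summand_at_def coord_add scale_left_distrib\<close>)
  have comb_scale: "comb q (s a v) = s a (comb q v)" if "q \<in> Q" "v \<in> V q" for q a v
    unfolding comb_def scale_sum_right
    by (rule sum.cong) (use that in \<open>auto simp: summand_at_def coord_scale\<close>)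
  have CV: "\<And>p v. v \<in> compl p \<Longrightarrow> v \<in> V p" by (simp add: compl_def)
  have eC: "e q \<in> compl q" if "q \<in> Q" for q using E.gen_in[of "(J, e, \<rho>)" q] that by simp
  have block: "is_block J" "J \<inter> Q \<noteq> {}" using E.summand by (auto simp: block_summand_def)
  have new: "block_summand s Q V f J e \<pi>"
    unfolding block_summand_def
  proof (intro conjI ballI impI allI)
    fix q assume q: "q \<in> Q"
    show "e q \<in> V q" using CV eC[OF q] .
    show "e q = 0" if "q \<notin> J" using E.gen_out[of "(J, e, \<rho>)" q] q that by simp
    show "\<pi> q (e q) = 1" if "q \<in> J"
      using E.coord_gen[of "(J, e, \<rho>)" q] q that comb_compl[OF eC[OF q]] by (simp add: \<pi>_def)
    fix v assume v: "v \<in> V q"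
    show "\<pi> q v = 0" if "q \<notin> J"
      using E.coord_out[of "(J, e, \<rho>)" q "v - comb q v"] q that compl_proj[OF q v] by (simp add: \<pi>_def)
    show "\<pi> q (s a v) = a * \<pi> q v" for a
      using E.coord_scale[of "(J, e, \<rho>)" q "v - comb q v" a] q compl_proj[OF q v] comb_scale[OF q v]
      by (simp add: \<pi>_def scale_right_diff_distrib)
    show "\<pi> q (v + w) = \<pi> q v + \<pi> q w" if w: "w \<in> V q" for w
      using E.coord_add[of "(J, e, \<rho>)" q "v - comb q v" "w - comb q w"] q compl_proj[OF q v] compl_proj[OF q w]
        comb_add[OF q v w]
      by (simp add: \<pi>_def algebra_simps)
  next
    fix q r assume qr: "q \<in> Q" "r \<in> Q" "le2 q r"
    show "f q r (e q) = e r" if "q \<in> J" using E.gen_f[of "(J, e, \<rho>)" q r] qr that by simp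
    show "\<pi> r (f q r v) = \<pi> q v" if "r \<in> J" "v \<in> V q" for v
    proof -
      have "f q r v - comb r (f q r v) = f q r (v - comb q v)"
        using comb_f[OF qr(1,3) that(2)] f_diff[OF qr(1,3) that(2) comb_in[OF qr(1)]] by simp
      then show ?thesis
        using E.coord_f[of "(J, e, \<rho>)" q r "v - comb q v"] qr that compl_proj[OF qr(1) that(2)]
        by (simp add: \<pi>_def)
    qed
  qed (rule block)+
  have "t \<notin> \<F>"
  proof
    assume tF: "t \<in> \<F>"
    obtain q where q: "q \<in> J" "q \<in> Q" using block by blast
    have "coord t q (gen t q) = 1" using coord_gen[OF tF q(2)] q by (simp add: t_def)
    moreover have "\<forall>u\<in>\<F>. coord u q (e q) = 0" using eC[OF q(2)] by (simp add: compl_def)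
    from bspec[OF this tF] have "coord t q (gen t q) = 0" by (simp add: t_def)
    ultimately show False by simp
  qed
  have coord_e: "coord u q (e q) = 0" if "u \<in> \<F>" "q \<in> Q" for u q
    using eC[OF that(2)] that(1) by (simp add: compl_def)
  have \<pi>_gen: "\<pi> q (gen u q) = 0" if u: "u \<in> \<F>" "q \<in> Q" for u q
  proof -
    have "gen u q - comb q (gen u q) = 0"
    proof (cases "q \<in> fst u")
      case True
      have "comb q (gen u q) = (\<Sum>t\<in>summand_at \<F> q. if t = u then gen u q else 0)"
        unfolding comb_def
        by (rule sum.cong) (use u True orthogonal coord_gen in \<open>auto simp: summand_at_def\<close>)
      also have "\<dots> = gen u q"
        using finite_summand_at[OF u(2)] u True by (simp add: summand_at_def)
      finally show ?thesis by simp
    next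
      case False
      then have "gen u q = 0" using gen_out u by blast
      then show ?thesis using comb_compl[of 0 q] subspace_0[OF C.sub[OF u(2)]] by simp
    qed
    then show ?thesis using E.coord_zero[of "(J, e, \<rho>)" q] u by (simp add: \<pi>_def)
  qed
  have "orthogonal_summands s Q V f (insert t \<F>)"
  proof unfold_locales
    fix u assume "u \<in> insert t \<F>"
    then show "block_summand s Q V f (fst u) (gen u) (coord u)"
      using new summand[of u] by (cases "u = t") (simp_all add: t_def)
  next
    fix u u' q assume u: "u \<in> insert t \<F>" "u' \<in> insert t \<F>" "u \<noteq> u'" "q \<in> Q"
    then consider "u = t" "u' \<in> \<F>" | "u' = t" "u \<in> \<F>" | "u \<in> \<F>" "u' \<in> \<F>" by blast
    then show "coord u q (gen u' q) = 0"
    proof cases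
      case 1
      then show ?thesis using \<pi>_gen[OF 1(2) u(4)] by (simp add: t_def)
    next
      case 2
      then show ?thesis using coord_e[OF 2(2) u(4)] by (simp add: t_def)
    next
      case 3
      then show ?thesis using orthogonal u by blast
    qed
  qed
  then show ?thesis using \<open>t \<notin> \<F>\<close> by blast
qed

end

section \<open>A maximal family and the resulting isomorphism\<close>

context middle_exact_module
begin

lemma complete_orthogonal_summands:
  obtains \<F> where "orthogonal_summands s Q V f \<F>"
    "\<And>p v. p \<in> Q \<Longrightarrow> v \<in> V p \<Longrightarrow> (\<And>t. t \<in> \<F> \<Longrightarrow> coord t p v = 0) \<Longrightarrow> v = 0"
proof -
  let ?A = "{\<F>. orthogonal_summands s Q V f \<F>}"
  have "{} \<in> ?A" by (rule CollectI) (unfold_locales; simp)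
  then have "?A \<noteq> {}" by blast
  then have "\<exists>M\<in>?A. \<forall>X\<in>?A. M \<subseteq> X \<longrightarrow> X = M"
  proof (rule subset_Zorn_nonempty)
    fix \<C> assume ne: "\<C> \<noteq> {}" and ch: "subset.chain ?A \<C>"
    have C: "orthogonal_summands s Q V f \<G>" if "\<G> \<in> \<C>" for \<G>
      using ch that by (auto simp: subset.chain_def)
    have "orthogonal_summands s Q V f (\<Union>\<C>)"
    proof unfold_locales
      fix t assume "t \<in> \<Union>\<C>"
      then show "block_summand s Q V f (fst t) (gen t) (coord t)"
        using C orthogonal_summands.summand by blast
    next
      fix t t' p assume t: "t \<in> \<Union>\<C>" "t' \<in> \<Union>\<C>" "t \<noteq> t'" "p \<in> Q"
      \<comment> \<open>Orthogonality involves only two summands at a time, and two members of the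
        union lie in one member of the chain.\<close>
      obtain \<G> where "\<G> \<in> \<C>" "{t, t'} \<subseteq> \<G>"
        by (rule finite_subset_Union_chain[OF _ _ ne ch, of "{t, t'}"]) (use t in auto)
      then show "coord t p (gen t' p) = 0"
        using orthogonal_summands.orthogonal[OF C] t by auto
    qed
    then show "\<Union>\<C> \<in> ?A" by simp
  qed
  then obtain \<F> where F: "orthogonal_summands s Q V f \<F>"
    and max: "\<And>X. orthogonal_summands s Q V f X \<Longrightarrow> \<F> \<subseteq> X \<Longrightarrow> X = \<F>" by blast
  interpret orthogonal_summands s Q V f \<F> by (rule F)
  have "v = 0" if p: "p \<in> Q" "v \<in> V p" "\<And>t. t \<in> \<F> \<Longrightarrow> coord t p v = 0" for p v
  proof (rule ccontr)
    assume "v \<noteq> 0"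
    then obtain t where "t \<notin> \<F>" "orthogonal_summands s Q V f (insert t \<F>)"
      using extend_orthogonal[OF p(1), of v] p(2,3) by (auto simp: compl_def)
    then show False using max[of "insert t \<F>"] by blast
  qed
  then show thesis using that F by blast
qed

text \<open>The coordinates form the isomorphism: completeness makes it injective, and finite
  combinations of generators make it surjective.\<close>

theorem block_decomposable: "block_decomposable s Q V f"
proof -
  obtain \<F> where F: "orthogonal_summands s Q V f \<F>"
    and complete: "\<And>p v. p \<in> Q \<Longrightarrow> v \<in> V p \<Longrightarrow> (\<And>t. t \<in> \<F> \<Longrightarrow> coord t p v = 0) \<Longrightarrow> v = 0"
    using complete_orthogonal_summands by blast
  interpret orthogonal_summands s Q V f \<F> by (rule F)
  have "\<forall>t\<in>\<F>. \<exists>p. p \<in> fst t \<inter> Q" using summand unfolding block_summand_def by blast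
  then obtain loc where loc: "\<And>t. t \<in> \<F> \<Longrightarrow> loc t \<in> fst t \<inter> Q" by metis
  \<comment> \<open>To fit the index type, a summand is labelled by a chosen point of its block
    together with its number among the finitely many summands whose blocks contain that
    point.\<close>
  define \<iota> where "\<iota> t = (fst (loc t), snd (loc t), to_nat_on (summand_at \<F> (loc t)) t)" for t
  have inj: "inj_on \<iota> \<F>"
  proof (rule inj_onI)
    fix t t' assume t: "t \<in> \<F>" "t' \<in> \<F>" "\<iota> t = \<iota> t'"
    then have l: "loc t = loc t'" by (simp add: \<iota>_def prod_eq_iff)
    have "countable (summand_at \<F> (loc t))"
      using finite_summand_at[of "loc t"] loc[OF t(1)] by (simp add: countable_finite)
    moreover have "t \<in> summand_at \<F> (loc t)" "t' \<in> summand_at \<F> (loc t)"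
      using loc[OF t(1)] loc[OF t(2)] t l by (auto simp: summand_at_def)
    ultimately show "t = t'" using t(3) l by (simp add: \<iota>_def)
  qed
  define I where "I = \<iota> ` \<F>"
  define \<tau> where "\<tau> = inv_into \<F> \<iota>"
  have \<tau>: "\<tau> (\<iota> t) = t" if "t \<in> \<F>" for t using inj that by (simp add: \<tau>_def)
  have \<tau>F: "\<tau> i \<in> \<F>" "\<iota> (\<tau> i) = i" if "i \<in> I" for i
    using that by (auto simp: I_def \<tau>)
  define J where "J i = fst (\<tau> i)" for i
  define \<phi> where "\<phi> p v i = (if i \<in> I then coord (\<tau> i) p v else 0)" for p v i
  have "iso_to_dsum s Q V f I J"
    unfolding iso_to_dsum_def
  proof (rule exI[of _ \<phi>], intro conjI ballI allI impI)
    fix p assume p: "p \<in> Q"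
    have supp: "finite {i \<in> I. p \<in> J i}"
    proof (rule finite_subset)
      show "{i \<in> I. p \<in> J i} \<subseteq> \<iota> ` summand_at \<F> p"
        by (auto simp: I_def J_def summand_at_def \<tau>)
    qed (simp add: finite_summand_at[OF p])
    show "bij_betw (\<phi> p) (V p) (dsum_space Q I J p)"
      unfolding bij_betw_def
    proof (intro conjI inj_onI subset_antisym subsetI)
      fix v w assume vw: "v \<in> V p" "w \<in> V p" "\<phi> p v = \<phi> p w"
      have "coord t p (v - w) = 0" if t: "t \<in> \<F>" for t
      proof -
        have "\<phi> p v (\<iota> t) = \<phi> p w (\<iota> t)" using vw(3) by simp
        then show ?thesis using t coord_diff[OF t p vw(1,2)] by (simp add: \<phi>_def I_def \<tau>)
      qed
      then have "v - w = 0" using complete[OF p diff_in[OF p vw(1,2)]] by blast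
      then show "v = w" by simp
    next
      fix c :: "real \<times> real \<times> nat \<Rightarrow> 'k" assume "c \<in> \<phi> p ` V p"
      then obtain v where v: "v \<in> V p" "c = \<phi> p v" by blast
      have nz: "i \<in> I \<and> p \<in> J i" if "c i \<noteq> 0" for i
        using that coord_out[OF \<tau>F(1) p _ v(1), of i] by (auto simp: v(2) \<phi>_def J_def split: if_splits)
      then have "finite {i. c i \<noteq> 0}" by (intro finite_subset[OF _ supp]) blast
      then show "c \<in> dsum_space Q I J p" using nz p by (simp add: dsum_space_def)
    next
      fix c :: "real \<times> real \<times> nat \<Rightarrow> 'k" assume "c \<in> dsum_space Q I J p"
      then have c: "i \<in> I" "p \<in> J i" if "c i \<noteq> 0" for i using that unfolding dsum_space_def by blast+
      define v where "v = (\<Sum>t\<in>summand_at \<F> p. s (c (\<iota> t)) (gen t p))"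
      have v: "v \<in> V p"
        unfolding v_def by (intro subspace_sum sub scale_in gen_in p) (auto simp: summand_at_def)
      have "\<phi> p v i = c i" for i
      proof (cases "i \<in> I")
        case True
        then show ?thesis
          using coord_comb[OF \<tau>F(1)[OF True] p, of "\<lambda>t. c (\<iota> t)"] c[of i] \<tau>F(2)[OF True]
          by (auto simp: \<phi>_def v_def J_def)
      next
        case False
        then show ?thesis using c[of i] by (auto simp: \<phi>_def)
      qed
      then have "c = \<phi> p v" by auto
      then show "c \<in> \<phi> p ` V p" using v by blast
    qed
    show "\<phi> p (v + w) i = \<phi> p v i + \<phi> p w i" if "v \<in> V p" "w \<in> V p" for v w i
      using that p \<tau>F by (simp add: \<phi>_def coord_add)
    show "\<phi> p (s a v) i = a * \<phi> p v i" if "v \<in> V p" for a v i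
      using that p \<tau>F by (simp add: \<phi>_def coord_scale)
  next
    fix p q v assume pq: "p \<in> Q" "q \<in> Q" "le2 p q" and v: "v \<in> V p"
    show "\<phi> q (f p q v) = dsum_map Q J p q (\<phi> p v)"
    proof
      fix i
      show "\<phi> q (f p q v) i = dsum_map Q J p q (\<phi> p v) i"
        using coord_f[OF \<tau>F(1) pq(1,3) _ v, of i] coord_out[OF \<tau>F(1) pq(2) _ f_in[OF pq(1,3) v], of i] pq(2)
        by (auto simp: \<phi>_def dsum_map_def J_def)
    qed
  qed
  moreover have "is_block (J i) \<and> J i \<inter> Q \<noteq> {}" if "i \<in> I" for i
    using summand[OF \<tau>F(1)[OF that]] by (simp add: J_def block_summand_def)
  ultimately show ?thesis unfolding block_decomposable_def by blast
qed

end

section \<open>The two half-planes\<close>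

lemma middle_exact_module_T_open:
  assumes "pers_module s T_open V f" "pointwise_fin_dim s T_open V" "middle_exact T_open V f"
  shows "middle_exact_module s T_open V f"
proof -
  interpret vector_space s using assms(1) by (simp add: pers_module_def)
  show ?thesis
  proof unfold_locales
    show "q \<in> T_open" if "p \<in> T_open" "le2 p q" for p q
      using that by (cases p, cases q) (simp add: T_open_def)
    fix F assume F: "finite F" "F \<subseteq> T_open"
    \<comment> \<open>The smallest coordinate sum occurring in \<open>F\<close> is positive; the
      extra value 1 covers the empty set.\<close>
    define c where "c = Min (insert 1 ((\<lambda>q. fst q + snd q) ` F))"
    have "c > 0" unfolding c_def using F by (auto simp: T_open_def)
    moreover have "\<forall>q\<in>F. c \<le> fst q + snd q" unfolding c_def using F(1) by auto
    ultimately show "\<exists>c. (\<forall>x. (x, c - x) \<in> T_open) \<and> (\<forall>q\<in>F. c \<le> fst q + snd q)"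
      by (intro exI[of _ c]) (simp add: T_open_def)
  qed (rule assms)+
qed

lemma middle_exact_module_T_closed:
  assumes "pers_module s T_closed V f" "pointwise_fin_dim s T_closed V" "middle_exact T_closed V f"
  shows "middle_exact_module s T_closed V f"
proof -
  interpret vector_space s using assms(1) by (simp add: pers_module_def)
  show ?thesis
  proof unfold_locales
    show "q \<in> T_closed" if "p \<in> T_closed" "le2 p q" for p q
      using that by (cases p, cases q) (simp add: T_closed_def)
    \<comment> \<open>The boundary line itself lies in the closed half-plane, so
      \<open>c = 0\<close> works for every \<open>F\<close>.\<close>
    show "\<exists>c. (\<forall>x. (x, c - x) \<in> T_closed) \<and> (\<forall>q\<in>F. c \<le> fst q + snd q)" if "F \<subseteq> T_closed" for F
      using that by (intro exI[of _ 0]) (auto simp: T_closed_def)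
  qed (rule assms)+
qed

theorem theorem1p4:
  shows "(\<forall>(s :: 'k::field \<Rightarrow> 'v::ab_group_add \<Rightarrow> 'v) V f.
            pers_module s T_open V f \<and> pointwise_fin_dim s T_open V \<and> middle_exact T_open V f
              \<longrightarrow> block_decomposable s T_open V f) \<and>
         (\<forall>(s :: 'k::field \<Rightarrow> 'v::ab_group_add \<Rightarrow> 'v) V f.
            pers_module s T_closed V f \<and> pointwise_fin_dim s T_closed V \<and> middle_exact T_closed V f
              \<longrightarrow> block_decomposable s T_closed V f)"
  using middle_exact_module.block_decomposable[OF middle_exact_module_T_open]
    middle_exact_module.block_decomposable[OF middle_exact_module_T_closed] by blast

end
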